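(* Let $X$ be a closed set in $\mathbb{R}^n$ and let $S=F\circ S_0$ for a mapping $S_0:\mathbb{R}^n\rightrightarrows\mathbb{R}^p$ that is outer semicontinuous relative to $X$ and a single-valued function $F:\mathbb{R}^p\to\mathbb{R}^m$. Let $\bar{u}\in S|_X(\bar{x})$ and suppose $F$ is strictly continuous at every $\bar{w}\in S_0(\bar{x})$. Suppose also that the mapping $(x,u)\mapsto S_0|_X(x)\cap F^{-1}(u)$ is locally bounded at $(\bar{x},\bar{u})$. Then $$D^*_XS(\bar{x}\mid\bar{u})\subseteq\bigcup_{\bar{w}\in S_0(\bar{x})\cap F^{-1}(\bar{u})}D^*_XS_0(\bar{x}\mid\bar{w})\circ D^*F(\bar{w}).$$ If in addition $S_0|_X$ is graph-convex, $X$ is a smooth manifold around $\bar{x}$, and $F$ is linear, then $$D^*_XS(\bar{x}\mid\bar{u})=D^*_XS_0(\bar{x}\mid\bar{w})\circ\nabla F(\bar{w})^*\qquad\forall\,\bar{w}\in S_0(\bar{x})\cap F^{-1}(\bar{u}).$$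
   Context: For $C\subseteq\mathbb{R}^n$ and $x\in C$: $T_C(x)=\limsup_{t\searrow 0}\frac{C-x}{t}$ (outer limit) is the tangent (contingent) cone; the regular normal cone is $\widehat{N}_C(x)=\{v\mid \limsup_{x'\to x,\,x'\in C,\,x'\neq x}\langle v,x'-x\rangle/\|x'-x\|\le 0\}$; the limiting normal cone $N_C(x)$ is the set of $v$ for which there are $x_k\to x$, $x_k\in C$, and $v_k\to v$ with $v_k\in\widehat{N}_C(x_k)$. These are empty for $x\notin C$. $\operatorname{proj}_C(x)=\{y\in C\mid\|y-x\|=d(x,C)\}$ and $\operatorname{proj}_CA=\bigcup_{a\in A}\operatorname{proj}_C(a)$. For a set-valued mapping $S$, $\operatorname{gph}S=\{(x,u)\mid u\in S(x)\}$; $S|_X$ equals $S(x)$ for $x\in X$ and $\emptyset$ for $x\notin X$; $(A\circ B)(y)=\bigcup_{z\in B(y)}A(z)$; inclusions and unions of mappings are understood argumentwise. A mapping is graph-convex if its graph is convex. The coderivative is defined by $x^*\in D^*S(\bar{x}\mid\bar{u})(u^* )\iff(x^*,-u^* )\in N_{\operatorname{gph}S}(\bar{x},\bar{u})$; for single-valued $F$, $D^*F(\bar{w})=D^*F(\bar{w}\mid F(\bar{w}))$. The projectional coderivative (for $\bar{x}\in X$, $\bar{u}\in S(\bar{x})$, $S:\mathbb{R}^n\rightrightarrows\mathbb{R}^m$) is defined by $$t^*\in D^*_XS(\bar{x}\mid\bar{u})(u^* )\iff(t^*,-u^* )\in\limsup_{(x,u)\to(\bar{x},\bar{u}),\,(x,u)\in\operatorname{gph}S|_X}\operatorname{proj}_{T_X(x)\times\mathbb{R}^m}N_{\operatorname{gph}S|_X}(x,u),$$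 with $\limsup$ the (Painlevé–Kuratowski) outer limit of sets. $S$ is outer semicontinuous relative to $X$ if $\limsup_{x\to x_0,\,x\in X}S(x)=S(x_0)$ for every $x_0\in X$. A mapping is locally bounded at a point if the image of some neighborhood of the point is bounded. $F$ is strictly continuous at $\bar{w}$ if it is Lipschitz continuous on some neighborhood of $\bar{w}$. $X$ is a ($d$-dimensional) smooth manifold around $\bar{x}\in X$ if there are an open neighborhood $O$ of $\bar{x}$ and a $\mathcal{C}^1$ mapping $G:O\to\mathbb{R}^{n-d}$ with $\nabla G(\bar{x})$ of full rank $n-d$ such that $X\cap O=\{x\in O\mid G(x)=0\}$. *)

theory Defs
  imports "HOL-Analysis.Analysis"
begin

text \<open>Set-valued mappings from \<open>'a\<close> to \<open>'b\<close> are functions \<open>'a \<Rightarrow> 'b set\<close>.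
  Products such as \<open>\<real>\<^sup>n \<times> \<real>\<^sup>m\<close> are product types, with the Euclidean norm and inner product.\<close>

definition gph :: "('a \<Rightarrow> 'b set) \<Rightarrow> ('a \<times> 'b) set" where
  "gph S = {(x, u). u \<in> S x}"

definition restrict_map_to :: "('a \<Rightarrow> 'b set) \<Rightarrow> 'a set \<Rightarrow> 'a \<Rightarrow> 'b set" where
  "restrict_map_to S X x = (if x \<in> X then S x else {})"

definition sv_comp :: "('b \<Rightarrow> 'c set) \<Rightarrow> ('a \<Rightarrow> 'b set) \<Rightarrow> 'a \<Rightarrow> 'c set" where
  "sv_comp A B y = (\<Union>z\<in>B y. A z)"

definition single_valued_map :: "('a \<Rightarrow> 'b) \<Rightarrow> 'a \<Rightarrow> 'b set" where
  "single_valued_map F x = {F x}"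

definition graph_convex :: "('a::real_vector \<Rightarrow> 'b::real_vector set) \<Rightarrow> bool" where
  "graph_convex S \<longleftrightarrow> convex (gph S)"

text \<open>The Painleve-Kuratowski outer limit of \<open>S y\<close> as \<open>y\<close> tends to \<open>z\<close> within \<open>D\<close>.
  As usual in variational analysis, \<open>y = z\<close> is admitted whenever \<open>z \<in> D\<close>.\<close>

definition outer_limit ::
    "'a::topological_space set \<Rightarrow> 'a \<Rightarrow> ('a \<Rightarrow> 'b::topological_space set) \<Rightarrow> 'b set" where
  "outer_limit D z S =
     {v. \<exists>y w. (\<forall>k::nat. y k \<in> D) \<and> y \<longlonglongrightarrow> z \<and> (\<forall>k. w k \<in> S (y k)) \<and> w \<longlonglongrightarrow> v}"

definition osc_relative ::
    "('a::topological_space \<Rightarrow> 'b::topological_space set) \<Rightarrow> 'a set \<Rightarrow> bool" where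
  "osc_relative S X \<longleftrightarrow> (\<forall>x0\<in>X. outer_limit X x0 S = S x0)"

definition locally_bounded_at ::
    "('a::topological_space \<Rightarrow> 'b::metric_space set) \<Rightarrow> 'a \<Rightarrow> bool" where
  "locally_bounded_at S z \<longleftrightarrow> (\<exists>V. open V \<and> z \<in> V \<and> bounded (\<Union>y\<in>V. S y))"

definition strictly_continuous_at ::
    "('a::metric_space \<Rightarrow> 'b::metric_space) \<Rightarrow> 'a \<Rightarrow> bool" where
  "strictly_continuous_at F w \<longleftrightarrow> (\<exists>V L. open V \<and> w \<in> V \<and> L-lipschitz_on V F)"

definition tangent_cone :: "'a::real_normed_vector set \<Rightarrow> 'a \<Rightarrow> 'a set" where
  "tangent_cone C x =
     (if x \<in> C then outer_limit {0<..} (0::real) (\<lambda>t. (\<lambda>c. (c - x) /\<^sub>R t) ` C) else {})"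

text \<open>The upper limit is taken in the extended reals, so that it is \<open>-\<infinity>\<close> at isolated points of \<open>C\<close>.\<close>

definition regular_normal_cone :: "'a::real_inner set \<Rightarrow> 'a \<Rightarrow> 'a set" where
  "regular_normal_cone C x =
     (if x \<in> C
      then {v. Limsup (at x within C) (\<lambda>x'. ereal (v \<bullet> (x' - x) / norm (x' - x))) \<le> 0}
      else {})"

definition limiting_normal_cone :: "'a::real_inner set \<Rightarrow> 'a \<Rightarrow> 'a set" where
  "limiting_normal_cone C x =
     (if x \<in> C then outer_limit C x (regular_normal_cone C) else {})"

definition proj_point :: "'a::metric_space set \<Rightarrow> 'a \<Rightarrow> 'a set" where
  "proj_point C x = {y \<in> C. dist y x = infdist x C}"

definition proj_set :: "'a::metric_space set \<Rightarrow> 'a set \<Rightarrow> 'a set" where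
  "proj_set C A = (\<Union>a\<in>A. proj_point C a)"

definition coderivative ::
    "('a::real_inner \<Rightarrow> 'b::real_inner set) \<Rightarrow> 'a \<Rightarrow> 'b \<Rightarrow> 'b \<Rightarrow> 'a set" where
  "coderivative S x u u' = {x'. (x', - u') \<in> limiting_normal_cone (gph S) (x, u)}"

definition coderivative_fun ::
    "('a::real_inner \<Rightarrow> 'b::real_inner) \<Rightarrow> 'a \<Rightarrow> 'b \<Rightarrow> 'a set" where
  "coderivative_fun F w = coderivative (single_valued_map F) w (F w)"

definition proj_coderivative ::
    "'a::real_inner set \<Rightarrow> ('a \<Rightarrow> 'b::real_inner set) \<Rightarrow> 'a \<Rightarrow> 'b \<Rightarrow> 'b \<Rightarrow> 'a set" where
  "proj_coderivative X S x u u' =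
     {t'. (t', - u') \<in> outer_limit (gph (restrict_map_to S X)) (x, u)
        (\<lambda>(y, v). proj_set (tangent_cone X y \<times> UNIV)
                    (limiting_normal_cone (gph (restrict_map_to S X)) (y, v)))}"

text \<open>Since \<open>d\<close> is a variable, the mapping \<open>G\<close> into \<open>\<real>\<^sup>n\<^sup>-\<^sup>d\<close> is given by its components
  \<open>G i\<close> for \<open>i < n - d\<close>; the gradients \<open>DG i y\<close> are the rows of the Jacobian of \<open>G\<close> at \<open>y\<close>,
  whose rank is therefore the dimension of their span.\<close>

definition smooth_manifold_around :: "nat \<Rightarrow> 'a::euclidean_space set \<Rightarrow> 'a \<Rightarrow> bool" where
  "smooth_manifold_around d X x \<longleftrightarrow>
     x \<in> X \<and> d \<le> DIM('a) \<and>
     (\<exists>U (G :: nat \<Rightarrow> 'a \<Rightarrow> real) (DG :: nat \<Rightarrow> 'a \<Rightarrow> 'a).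
        open U \<and> x \<in> U \<and>
        (\<forall>i < DIM('a) - d. (\<forall>y\<in>U. GDERIV (G i) y :> DG i y) \<and> continuous_on U (DG i)) \<and>
        dim ((\<lambda>i. DG i x) ` {..< DIM('a) - d}) = DIM('a) - d \<and>
        X \<inter> U = {y \<in> U. \<forall>i < DIM('a) - d. G i y = 0})"

end

theory Submission
  imports Defs
begin

text \<open>
  Throughout, \<open>C\<close> is the graph of \<open>S\<^sub>0\<close> restricted to \<open>X\<close>; the graph of the restriction of
  \<open>F \<circ> S\<^sub>0\<close> is then the image of \<open>C\<close> under \<open>(x, w) \<mapsto> (x, F w)\<close>.

  \<^bold>\<open>The inclusion.\<close> A regular normal \<open>(v, -u)\<close> to the image at \<open>(x\<^sub>0, F w\<^sub>0)\<close> says that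
  \<open>v \<bullet> x - u \<bullet> F w\<close> is, up to first order, maximal over \<open>C\<close> at \<open>(x\<^sub>0, w\<^sub>0)\<close>. Decoupling the
  argument of \<open>F\<close> from \<open>w\<close> by a quadratic penalty splits the optimality condition into a regular
  normal \<open>(z, -u)\<close> to the graph of \<open>F\<close> and a regular normal close to \<open>(v, -z)\<close> to \<open>C\<close>, both at
  points close to the original ones (\<open>fuzzy_chain_rule\<close>). The multiplier \<open>z\<close> is bounded by the
  Lipschitz constant of \<open>F\<close>, so limits can be taken (\<open>chain_rule_limiting_normal\<close>): a limiting
  normal \<open>(v, -u)\<close> to the image yields \<open>z \<in> D\<^sup>*F(w)(u)\<close> such that \<open>(v, -z)\<close> is a limiting normal
  to \<open>C\<close>. Local boundedness supplies the points \<open>w\<close> by compactness (\<open>lift_limiting_normal\<close>).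
  The component \<open>v\<close> and the point of \<open>X\<close> are exactly the same on both sides, so projecting \<open>v\<close>
  to the tangent cone of \<open>X\<close> commutes with this step, and one more passage to the limit gives
  the chain rule for projectional coderivatives (\<open>proj_coderivative_chain_rule\<close>).

  \<^bold>\<open>The equality.\<close> Near a point of a smooth manifold the tangent cones of \<open>X\<close> are subspaces, and
  limits of vectors tangent at nearby points are tangent (\<open>smooth_manifold_tangent_spaces\<close>).
  If \<open>C\<close> is convex, all directions of its projection to \<open>X\<close> are tangent to \<open>X\<close>, whence the part
  of \<open>v\<close> that the projection to the tangent space removes does not affect whether \<open>(v, -z)\<close> is
  normal to \<open>C\<close>.
  The outer limit of projected normals collapses therefore to the normals at the base point whose
  first component is tangent (\<open>outer_limit_projected_normals_convex\<close>). When \<open>F\<close> is linear, the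
  image of \<open>C\<close> is convex too, and its normals are \<open>(v, -u)\<close> with \<open>(v, -F\<^sup>*u)\<close> normal to \<open>C\<close>:
  this depends on \<open>u\<close> and \<open>v\<close> only, and holds at every preimage \<open>w\<close>.
\<close>

section \<open>Outer limits and normal cones\<close>

lemma le_zero_if_le_small_multiple:
  fixes a K :: real
  assumes "\<And>e. e > 0 \<Longrightarrow> a \<le> e * K" "K \<ge> 0"
  shows "a \<le> 0"
proof (rule field_le_epsilon)
  fix e :: real assume "e > 0"
  then have "a \<le> e / (K + 1) * K" using assms(2) by (intro assms(1)) (simp add: add_nonneg_pos)
  also have "\<dots> \<le> e" using \<open>e > 0\<close> \<open>K \<ge> 0\<close> by (simp add: divide_le_eq)
  finally show "a \<le> 0 + e" by simp
qed

text \<open>Replaces the choice of sequences by nearby points, so that repeated outer limits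
  can be composed with the triangle inequality instead of by diagonal sequences.\<close>

lemma outer_limit_iff:
  fixes D :: "'a::metric_space set" and S :: "'a \<Rightarrow> 'b::metric_space set"
  shows "v \<in> outer_limit D z S \<longleftrightarrow>
    (\<forall>e>0. \<exists>y\<in>D. dist y z < e \<and> (\<exists>w\<in>S y. dist w v < e))"
proof
  assume "v \<in> outer_limit D z S"
  then obtain y w where yw: "\<And>k. y k \<in> D" "y \<longlonglongrightarrow> z" "\<And>k. w k \<in> S (y k)" "w \<longlonglongrightarrow> v"
    unfolding outer_limit_def by blast
  show "\<forall>e>0. \<exists>y\<in>D. dist y z < e \<and> (\<exists>w\<in>S y. dist w v < e)"
  proof (intro allI impI)
    fix e :: real assume "e > 0"
    then have "\<forall>\<^sub>F k in sequentially. dist (y k) z < e \<and> dist (w k) v < e"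
      by (intro eventually_conj tendstoD[OF yw(2)] tendstoD[OF yw(4)])
    then obtain k where "dist (y k) z < e" "dist (w k) v < e"
      using eventually_happens'[OF sequentially_bot] by blast
    then show "\<exists>y\<in>D. dist y z < e \<and> (\<exists>w\<in>S y. dist w v < e)"
      using yw by blast
  qed
next
  assume *: "\<forall>e>0. \<exists>y\<in>D. dist y z < e \<and> (\<exists>w\<in>S y. dist w v < e)"
  have "\<exists>p. fst p \<in> D \<and> dist (fst p) z < inverse (real (Suc k))
      \<and> snd p \<in> S (fst p) \<and> dist (snd p) v < inverse (real (Suc k))" for k
    using *[rule_format, of "inverse (real (Suc k))"] by auto
  then obtain p where p: "\<And>k. fst (p k) \<in> D \<and> dist (fst (p k)) z < inverse (real (Suc k))
      \<and> snd (p k) \<in> S (fst (p k)) \<and> dist (snd (p k)) v < inverse (real (Suc k))"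
    by metis
  have lim: "(\<lambda>k. q k) \<longlonglongrightarrow> l" if "\<And>k. dist (q k) l < inverse (real (Suc k))"
    for q and l :: "'c::metric_space"
    unfolding tendsto_dist_iff[of q]
    by (rule Lim_null_comparison[OF always_eventually LIMSEQ_inverse_real_of_nat])
      (simp add: less_imp_le that del: of_nat_Suc)
  have "(\<lambda>k. fst (p k)) \<longlonglongrightarrow> z" "(\<lambda>k. snd (p k)) \<longlonglongrightarrow> v"
    using p by (auto intro!: lim)
  with p show "v \<in> outer_limit D z S"
    unfolding outer_limit_def by (intro CollectI exI[of _ "\<lambda>k. fst (p k)"] exI[of _ "\<lambda>k. snd (p k)"]) simp
qed

lemma outer_limit_eventuallyI:
  fixes y :: "nat \<Rightarrow> 'a::metric_space" and w :: "nat \<Rightarrow> 'b::metric_space"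
  assumes "\<forall>\<^sub>F k in sequentially. y k \<in> D \<and> w k \<in> S (y k)" "y \<longlonglongrightarrow> z" "w \<longlonglongrightarrow> v"
  shows "v \<in> outer_limit D z S"
  unfolding outer_limit_iff
proof (intro allI impI)
  fix e :: real assume "e > 0"
  then have "\<forall>\<^sub>F k in sequentially. dist (y k) z < e \<and> dist (w k) v < e \<and> y k \<in> D \<and> w k \<in> S (y k)"
    by (intro eventually_conj tendstoD[OF assms(2)] tendstoD[OF assms(3)] assms(1))
  then show "\<exists>y\<in>D. dist y z < e \<and> (\<exists>w\<in>S y. dist w v < e)"
    using eventually_happens'[OF sequentially_bot] by blast
qed

text \<open>Bounding the numerator by a multiple of \<open>norm (x' - x)\<close> avoids both the quotient and the
  upper limit; the vacuous case of an isolated point needs no separate treatment.\<close>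

lemma regular_normal_cone_iff:
  fixes C :: "'a::real_inner set"
  shows "v \<in> regular_normal_cone C x \<longleftrightarrow>
    x \<in> C \<and> (\<forall>e>0. \<exists>d>0. \<forall>x'\<in>C. dist x' x < d \<longrightarrow> v \<bullet> (x' - x) \<le> e * norm (x' - x))"
proof -
  let ?q = "\<lambda>x'. v \<bullet> (x' - x) / norm (x' - x)"
  have "Limsup (at x within C) (\<lambda>x'. ereal (?q x')) \<le> 0 \<longleftrightarrow>
      (\<forall>e>0. \<forall>\<^sub>F x' in at x within C. ?q x' \<le> e)"
  proof
    assume L: "Limsup (at x within C) (\<lambda>x'. ereal (?q x')) \<le> 0"
    show "\<forall>e>0. \<forall>\<^sub>F x' in at x within C. ?q x' \<le> e"
    proof (intro allI impI)
      fix e :: real assume "e > 0"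
      with L have "Limsup (at x within C) (\<lambda>x'. ereal (?q x')) < ereal e"
        by (metis ereal_less(2) order_le_less_trans)
      from Limsup_lessD[OF this] show "\<forall>\<^sub>F x' in at x within C. ?q x' \<le> e"
        by eventually_elim simp
    qed
  next
    assume *: "\<forall>e>0. \<forall>\<^sub>F x' in at x within C. ?q x' \<le> e"
    show "Limsup (at x within C) (\<lambda>x'. ereal (?q x')) \<le> 0"
    proof (rule ereal_le_epsilon2)
      fix e :: real assume "e > 0"
      with * have "\<forall>\<^sub>F x' in at x within C. ereal (?q x') \<le> ereal e" by simp
      from Limsup_bounded[OF this]
      show "Limsup (at x within C) (\<lambda>x'. ereal (?q x')) \<le> 0 + ereal e" by simp
    qed
  qed
  also have "\<dots> \<longleftrightarrow> (\<forall>e>0. \<exists>d>0. \<forall>x'\<in>C. dist x' x < d \<longrightarrow> v \<bullet> (x' - x) \<le> e * norm (x' - x))"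
  proof (intro all_cong1 imp_cong refl)
    fix e :: real
    have "(x' \<noteq> x \<and> dist x' x < d \<longrightarrow> ?q x' \<le> e)
        \<longleftrightarrow> (dist x' x < d \<longrightarrow> v \<bullet> (x' - x) \<le> e * norm (x' - x))" for x' d
      by (cases "x' = x") (auto simp: divide_simps)
    then show "(\<forall>\<^sub>F x' in at x within C. ?q x' \<le> e) \<longleftrightarrow>
        (\<exists>d>0. \<forall>x'\<in>C. dist x' x < d \<longrightarrow> v \<bullet> (x' - x) \<le> e * norm (x' - x))"
      unfolding eventually_at by simp
  qed
  finally show ?thesis unfolding regular_normal_cone_def by simp
qed

text \<open>A quadratic error is \<open>o(norm (x' - x))\<close>. All normals obtained below from minimization
  with quadratic penalties are of this proximal kind.\<close>

lemma proximal_normal_imp_regular: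
  fixes C :: "'a::real_inner set"
  assumes "x \<in> C" "r > 0"
    and prox: "\<And>x'. \<lbrakk>x' \<in> C; dist x' x < r\<rbrakk> \<Longrightarrow> v \<bullet> (x' - x) \<le> s * (norm (x' - x))\<^sup>2"
  shows "v \<in> regular_normal_cone C x"
  unfolding regular_normal_cone_iff
proof (intro conjI allI impI)
  fix e :: real assume "e > 0"
  define d where "d = min r (e / (\<bar>s\<bar> + 1))"
  have "v \<bullet> (x' - x) \<le> e * norm (x' - x)" if "x' \<in> C" "dist x' x < d" for x'
  proof -
    have "s * norm (x' - x) \<le> (\<bar>s\<bar> + 1) * norm (x' - x)"
      by (intro mult_right_mono) auto
    also have "\<dots> \<le> e"
      using that by (simp add: d_def dist_norm field_simps)
    finally have "s * norm (x' - x) * norm (x' - x) \<le> e * norm (x' - x)"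
      by (rule mult_right_mono) simp
    with prox[of x'] that show ?thesis
      by (simp add: d_def power2_eq_square mult.assoc)
  qed
  moreover have "d > 0" using assms \<open>e > 0\<close> by (simp add: d_def add_nonneg_pos)
  ultimately show "\<exists>d>0. \<forall>x'\<in>C. dist x' x < d \<longrightarrow> v \<bullet> (x' - x) \<le> e * norm (x' - x)"
    by blast
qed fact

lemma regular_imp_limiting_normal:
  fixes C :: "'a::real_inner set"
  assumes "v \<in> regular_normal_cone C x"
  shows "v \<in> limiting_normal_cone C x"
proof -
  have "x \<in> C" using assms by (simp add: regular_normal_cone_iff)
  with assms show ?thesis
    unfolding limiting_normal_cone_def
    by (auto intro!: outer_limit_eventuallyI[of "\<lambda>_. x" C "\<lambda>_. v"])
qed

lemma limiting_normal_cone_closed: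
  fixes C :: "'a::real_inner set"
  assumes "\<forall>\<^sub>F k in sequentially. v k \<in> limiting_normal_cone C (c k)"
    and "c \<longlonglongrightarrow> z" "v \<longlonglongrightarrow> n" "z \<in> C"
  shows "n \<in> limiting_normal_cone C z"
proof -
  have "\<exists>y\<in>C. dist y z < e \<and> (\<exists>w\<in>regular_normal_cone C y. dist w n < e)" if "e > 0" for e :: real
  proof -
    have "\<forall>\<^sub>F k in sequentially. dist (c k) z < e/2 \<and> dist (v k) n < e/2
        \<and> v k \<in> limiting_normal_cone C (c k)"
      by (intro eventually_conj tendstoD[OF assms(2)] tendstoD[OF assms(3)] assms(1) half_gt_zero that)
    then obtain k where k: "dist (c k) z < e/2" "dist (v k) n < e/2"
        "v k \<in> limiting_normal_cone C (c k)"
      using eventually_happens'[OF sequentially_bot] by blast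
    then have "v k \<in> outer_limit C (c k) (regular_normal_cone C)"
      by (simp add: limiting_normal_cone_def split: if_splits)
    then obtain y w where "y \<in> C" "dist y (c k) < e/2" "w \<in> regular_normal_cone C y" "dist w (v k) < e/2"
      using \<open>e > 0\<close> unfolding outer_limit_iff by (meson half_gt_zero)
    with k show ?thesis by (metis dist_triangle_half_r dist_commute)
  qed
  with assms(4) show ?thesis by (simp add: limiting_normal_cone_def outer_limit_iff)
qed

section \<open>Projections\<close>

lemma proj_point_iff:
  "y \<in> proj_point C x \<longleftrightarrow> y \<in> C \<and> (\<forall>c\<in>C. dist y x \<le> dist c x)"
proof -
  have "dist y x = infdist x C \<longleftrightarrow> (\<forall>c\<in>C. dist y x \<le> dist c x)" if "y \<in> C"
  proof -
    have "infdist x C \<le> dist y x" using infdist_le[OF that, of x] by (simp add: dist_commute)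
    moreover have "dist y x \<le> infdist x C" if "\<forall>c\<in>C. dist y x \<le> dist c x"
      using that \<open>y \<in> C\<close> by (auto simp: infdist_def dist_commute intro!: cINF_greatest)
    moreover have "infdist x C \<le> dist c x" if "c \<in> C" for c
      using infdist_le[OF that, of x] by (simp add: dist_commute)
    ultimately show ?thesis by force
  qed
  then show ?thesis unfolding proj_point_def by blast
qed

lemma proj_point_times_UNIV:
  "proj_point (T \<times> UNIV) (v, b) = proj_point T v \<times> {b}"
proof (intro set_eqI iffI)
  fix p assume "p \<in> proj_point (T \<times> UNIV) (v, b)"
  moreover obtain t b' where [simp]: "p = (t, b')" by fastforce
  ultimately have t: "t \<in> T" and le: "\<And>c. c \<in> T \<Longrightarrow> dist (t, b') (v, b) \<le> dist (c, b) (v, b)"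
    by (auto simp: proj_point_iff)
  have "(dist t v)\<^sup>2 + (dist b' b)\<^sup>2 \<le> (dist t v)\<^sup>2"
    using le[OF t] by (simp add: dist_Pair_Pair real_sqrt_le_iff' sqrt_le_D)
  then have "b' = b" by simp
  with t le show "p \<in> proj_point T v \<times> {b}" by (simp add: proj_point_iff dist_Pair_Pair)
next
  fix p assume "p \<in> proj_point T v \<times> {b}"
  then obtain t where [simp]: "p = (t, b)" and t: "t \<in> T" "\<And>c. c \<in> T \<Longrightarrow> dist t v \<le> dist c v"
    by (auto simp: proj_point_iff)
  have "dist (t, b) (v, b) \<le> dist (c, b') (v, b)" if "c \<in> T" for c b'
    using order_trans[OF t(2)[OF that] real_sqrt_sum_squares_ge1[of "dist c v" "dist b' b"]]
    by (simp add: dist_Pair_Pair)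
  with t(1) show "p \<in> proj_point (T \<times> UNIV) (v, b)"
    by (auto simp: proj_point_iff)
qed

lemma mem_proj_set_times_UNIV:
  "(t, b) \<in> proj_set (T \<times> UNIV) A \<longleftrightarrow> (\<exists>v. (v, b) \<in> A \<and> t \<in> proj_point T v)"
  unfolding proj_set_def by (fastforce simp: proj_point_times_UNIV)

lemma proj_point_self: "v \<in> T \<Longrightarrow> v \<in> proj_point T v"
  by (simp add: proj_point_iff)

text \<open>Otherwise a small step from \<open>t\<close> along \<open>y\<close> would decrease the distance to \<open>v\<close>; the proof
  uses the optimal step.\<close>

lemma proj_point_subspace_orthogonal:
  fixes T :: "'a::real_inner set"
  assumes "subspace T" "t \<in> proj_point T v" "y \<in> T"
  shows "(v - t) \<bullet> y = 0"
proof -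
  have tT: "t \<in> T" and min: "\<And>c. c \<in> T \<Longrightarrow> norm (v - t) \<le> norm (v - c)"
    using assms by (auto simp: proj_point_iff dist_norm norm_minus_commute)
  define a where "a = (v - t) \<bullet> y"
  show ?thesis
  proof (cases "y = 0")
    case False
    define s where "s = a / (y \<bullet> y)"
    have "norm (v - t) \<le> norm (v - t - s *\<^sub>R y)"
      using min[of "t + s *\<^sub>R y"] tT assms by (simp add: subspace_add subspace_scale algebra_simps)
    then have "(v - t) \<bullet> (v - t) \<le> (v - t - s *\<^sub>R y) \<bullet> (v - t - s *\<^sub>R y)"
      by (simp add: norm_le)
    also have "\<dots> = (v - t) \<bullet> (v - t) - 2 * s * a + s * (s * (y \<bullet> y))"
      unfolding a_def by (simp add: inner_diff_left inner_diff_right inner_commute algebra_simps)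
    also have "s * (y \<bullet> y) = a" using False by (simp add: s_def)
    finally have "s * a \<le> 0" by (simp add: mult.commute)
    moreover have "y \<bullet> y > 0" using False by simp
    ultimately have "a\<^sup>2 \<le> 0"
      by (auto simp: s_def power2_eq_square divide_le_0_iff)
    then show ?thesis by (simp add: a_def)
  qed simp
qed

section \<open>Normals to the image of a set under a Lipschitz map\<close>

text \<open>
  Minimize \<open>u \<bullet> F y - v \<bullet> x + norm ((x, w) - (x0, w0))\<^sup>2 / (2 t) + M norm (w - y)\<^sup>2\<close> over \<open>(x, w) \<in> C\<close>
  and \<open>y\<close>, both near the reference point. The variable \<open>y\<close> is the decoupled argument of \<open>F\<close>. For
  suitable \<open>t\<close> and \<open>M\<close> the minimizer is interior. Varying \<open>y\<close> alone
  then shows that \<open>z = 2 M (w - y)\<close> gives a proximal normal \<open>(z, -u)\<close> to the graph of \<open>F\<close>; varying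
  \<open>(x, w)\<close> alone shows that \<open>(v, -z)\<close>, corrected by the small gradient of the first penalty, is a
  proximal normal to \<open>C\<close>. The penalties being smooth, both normals are exact.
\<close>

lemma fuzzy_chain_rule:
  fixes C :: "('a::euclidean_space \<times> 'b::euclidean_space) set"
    and F :: "'b \<Rightarrow> 'c::euclidean_space"
  assumes "closed C" and c0: "(x0, w0) \<in> C"
    and W: "open W" "w0 \<in> W" and lip: "L-lipschitz_on W F"
    and normal: "(v, - u) \<in> regular_normal_cone ((\<lambda>(x, w). (x, F w)) ` C) (x0, F w0)"
    and "e > 0"
  obtains c y z q where
    "c \<in> C" "dist c (x0, w0) < e" "y \<in> W" "dist y w0 < e"
    "norm z \<le> 2 * L * norm u"
    "(z, - u) \<in> regular_normal_cone (gph (single_valued_map F)) (y, F y)"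
    "q \<in> regular_normal_cone C c" "dist q (v, - z) < e"
proof -
  define c0 where "c0 = (x0, w0)"
  have "L \<ge> 0" using lip by (rule lipschitz_on_nonneg)
  have lipF: "norm (F a - F b) \<le> L * norm (a - b)" if "a \<in> W" "b \<in> W" for a b
    using lipschitz_onD[OF lip that] by (simp add: dist_norm)
  have lipu: "\<bar>u \<bullet> F a - u \<bullet> F b\<bar> \<le> L * norm u * norm (a - b)" if "a \<in> W" "b \<in> W" for a b
  proof -
    have "\<bar>u \<bullet> F a - u \<bullet> F b\<bar> \<le> norm u * norm (F a - F b)"
      using Cauchy_Schwarz_ineq2[of u "F a - F b"] by (simp add: inner_diff_right)
    also have "\<dots> \<le> norm u * (L * norm (a - b))"
      by (intro mult_left_mono lipF that) simp
    finally show ?thesis by (simp add: mult_ac)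
  qed
  obtain r where "r > 0" and r: "cball w0 r \<subseteq> W"
    using W open_contains_cball by blast
  define h where "h = e / 4"
  have "h > 0" using \<open>e > 0\<close> by (simp add: h_def)
  obtain d1 where "d1 > 0" and d1: "\<And>p. \<lbrakk>p \<in> (\<lambda>(x, w). (x, F w)) ` C; dist p (x0, F w0) < d1\<rbrakk> \<Longrightarrow>
      (v, - u) \<bullet> (p - (x0, F w0)) \<le> h / (1 + L) * norm (p - (x0, F w0))"
    using normal \<open>h > 0\<close> \<open>L \<ge> 0\<close> unfolding regular_normal_cone_iff
    by (metis add_pos_nonneg divide_pos_pos zero_less_one)
  define d where "d = min (min r e) (d1 / (2 * (1 + L)))"
  have "d > 0" "d \<le> r" "d \<le> e"
    using \<open>r > 0\<close> \<open>e > 0\<close> \<open>d1 > 0\<close> \<open>L \<ge> 0\<close> by (auto simp: d_def)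
  have dL: "(1 + L) * d < d1"
  proof -
    have "(1 + L) * d \<le> (1 + L) * (d1 / (2 * (1 + L)))"
      using \<open>L \<ge> 0\<close> by (intro mult_left_mono) (auto simp: d_def)
    also have "\<dots> = d1 / 2" using \<open>L \<ge> 0\<close> by (simp add: field_simps)
    finally show ?thesis using \<open>d1 > 0\<close> by simp
  qed
  have ball_W: "snd c \<in> W" "snd c \<in> cball w0 r" if "dist c c0 \<le> d" for c
    using r that \<open>d \<le> r\<close> dist_snd_le[of c0 c] by (auto simp: c0_def dist_commute)
  \<comment> \<open>the regularity of the normal, transferred from the image to \<open>C\<close>: distances in the
    image are at most \<open>1 + L\<close> times those in \<open>C\<close>\<close>
  have reg: "v \<bullet> (x - x0) - u \<bullet> (F w - F w0) \<le> h * norm ((x, w) - c0)"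
    if "(x, w) \<in> C" "dist (x, w) c0 \<le> d" for x w
  proof -
    have "w \<in> W" using ball_W that by auto
    have "norm ((x, F w) - (x0, F w0)) \<le> (1 + L) * norm ((x, w) - c0)"
    proof -
      have "norm (F w - F w0) \<le> L * norm (w - w0)"
        by (rule lipF[OF \<open>w \<in> W\<close> W(2)])
      also have "\<dots> \<le> (1 + L) * norm (w - w0)"
        by (intro mult_right_mono) auto
      finally have "(norm (F w - F w0))\<^sup>2 \<le> ((1 + L) * norm (w - w0))\<^sup>2"
        by (intro power_mono) auto
      moreover have "(norm (x - x0))\<^sup>2 \<le> ((1 + L) * norm (x - x0))\<^sup>2"
        using \<open>L \<ge> 0\<close> by (intro power_mono) (auto simp: mult_le_cancel_right1)
      ultimately have "norm ((x, F w) - (x0, F w0)) \<le> sqrt ((1 + L)\<^sup>2 * ((norm (x - x0))\<^sup>2 + (norm (w - w0))\<^sup>2))"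
        by (simp add: norm_Pair power_mult_distrib distrib_left)
      also have "\<dots> = (1 + L) * norm ((x, w) - c0)"
        using \<open>L \<ge> 0\<close> by (simp add: c0_def norm_Pair real_sqrt_mult)
      finally show ?thesis .
    qed
    note le = this
    also have "\<dots> \<le> (1 + L) * d"
      using that \<open>L \<ge> 0\<close> by (intro mult_left_mono) (auto simp: dist_norm)
    also note dL
    finally have "dist (x, F w) (x0, F w0) < d1" by (simp add: dist_norm)
    then have "(v, - u) \<bullet> ((x, F w) - (x0, F w0)) \<le> h / (1 + L) * norm ((x, F w) - (x0, F w0))"
      using that by (intro d1) (auto intro!: image_eqI[of _ _ "(x, w)"])
    also have "\<dots> \<le> h / (1 + L) * ((1 + L) * norm ((x, w) - c0))"
      using le \<open>h > 0\<close> \<open>L \<ge> 0\<close> by (intro mult_left_mono) auto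
    also have "\<dots> = h * norm ((x, w) - c0)" using \<open>L \<ge> 0\<close> by simp
    finally show ?thesis by simp
  qed
  define K where "K = L * norm u"
  have "K \<ge> 0" using \<open>L \<ge> 0\<close> by (simp add: K_def)
  \<comment> \<open>the minimizer will satisfy \<open>norm (c - c0) \<le> 3 h t\<close>: this is less than \<open>d\<close>, and after division
    by \<open>t\<close> less than \<open>e = 4 h\<close>\<close>
  define t where "t = d / (4 * h)"
  have "t > 0" using \<open>d > 0\<close> \<open>h > 0\<close> by (simp add: t_def)
  \<comment> \<open>large enough for the coupling error \<open>K\<^sup>2 / (4 M)\<close> to be at most \<open>h\<^sup>2 t\<close> and for
    \<open>norm (w - y) \<le> K / M\<close> to be less than \<open>d / 4\<close>\<close>
  define M where "M = max (K\<^sup>2 / (4 * h\<^sup>2 * t)) (8 * K / d) + 1"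
  have "M > 0"
  proof -
    have "8 * K / d \<ge> 0" using \<open>K \<ge> 0\<close> \<open>d > 0\<close> by simp
    then show ?thesis by (simp add: M_def)
  qed
  have MK: "K\<^sup>2 / (4 * M) \<le> h\<^sup>2 * t"
  proof -
    have "K\<^sup>2 / (4 * h\<^sup>2 * t) \<le> M" by (simp add: M_def)
    then show ?thesis using \<open>M > 0\<close> \<open>t > 0\<close> \<open>h > 0\<close> by (simp add: field_simps)
  qed
  have Md: "K < M * (d / 4)"
  proof -
    have "8 * K / d < M" by (simp add: M_def)
    then show ?thesis using \<open>K \<ge> 0\<close> \<open>d > 0\<close> by (simp add: field_simps)
  qed
  define D where "D = (C \<inter> cball c0 d) \<times> cball w0 r"
  define f where "f = (\<lambda>(c, y). u \<bullet> F y - v \<bullet> fst c + (norm (c - c0))\<^sup>2 / (2 * t)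
    + M * (norm (snd c - y))\<^sup>2)"
  have "compact D"
    unfolding D_def using \<open>closed C\<close> by (intro compact_Times closed_Int_compact) auto
  moreover have start: "(c0, w0) \<in> D" using c0 \<open>d > 0\<close> \<open>r > 0\<close> by (simp add: D_def c0_def)
  moreover have "continuous_on D f"
  proof -
    have "continuous_on D (\<lambda>p. F (snd p))"
      using r by (intro continuous_on_compose2[OF lipschitz_on_continuous_on[OF lip]] continuous_intros)
        (auto simp: D_def)
    then show ?thesis
      unfolding f_def case_prod_unfold using \<open>t > 0\<close> by (intro continuous_intros) auto
  qed
  ultimately obtain m where m: "m \<in> D" "\<And>p. p \<in> D \<Longrightarrow> f m \<le> f p"
    using continuous_attains_inf[of D f] by blast
  obtain x w y where m_eq: "m = ((x, w), y)" by (metis prod.exhaust)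
  define c where "c = (x, w)"
  define \<rho> where "\<rho> = norm (c - c0)"
  define \<delta> where "\<delta> = norm (w - y)"
  have "c \<in> C" and cd: "dist c c0 \<le> d" and yr: "y \<in> cball w0 r"
    using m(1) by (auto simp: D_def m_eq c_def dist_commute)
  have "y \<in> W" using yr r by blast
  have "w \<in> W" "w \<in> cball w0 r" using ball_W[OF cd] by (auto simp: c_def)
  have fm: "f m = u \<bullet> F y - v \<bullet> x + \<rho>\<^sup>2 / (2 * t) + M * \<delta>\<^sup>2"
    by (simp add: f_def m_eq \<rho>_def \<delta>_def c_def)
  \<comment> \<open>moving \<open>y\<close> to \<open>w\<close> removes the coupling penalty at the price of the Lipschitz bound; this
    bounds both \<open>norm (w - y)\<close> and the multiplier\<close>
  have "f m \<le> f (c, w)"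
    using \<open>w \<in> cball w0 r\<close> \<open>c \<in> C\<close> cd by (intro m) (auto simp: D_def dist_commute)
  then have "M * \<delta>\<^sup>2 \<le> u \<bullet> F w - u \<bullet> F y"
    unfolding fm by (simp add: f_def \<rho>_def c_def)
  also have "\<dots> \<le> K * \<delta>"
    using lipu[OF \<open>w \<in> W\<close> \<open>y \<in> W\<close>] by (simp add: K_def \<delta>_def)
  finally have "M * \<delta> \<le> K"
    using \<open>K \<ge> 0\<close> by (cases "\<delta> = 0") (auto simp: power2_eq_square \<delta>_def)
  \<comment> \<open>comparison with the reference point bounds the displacement of \<open>c\<close>\<close>
  have "f m \<le> f (c0, w0)" by (rule m(2)[OF start])
  then have "\<rho>\<^sup>2 / (2 * t) + M * \<delta>\<^sup>2 \<le> v \<bullet> (x - x0) - u \<bullet> (F w - F w0) + (u \<bullet> F w - u \<bullet> F y)"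
    unfolding fm by (simp add: f_def c0_def inner_diff_right)
  also have "\<dots> \<le> h * \<rho> + K * \<delta>"
    using reg[of x w] \<open>c \<in> C\<close> cd lipu[OF \<open>w \<in> W\<close> \<open>y \<in> W\<close>]
    by (simp add: K_def \<delta>_def \<rho>_def c_def)
  finally have "\<rho>\<^sup>2 / (2 * t) \<le> h * \<rho> + (K * \<delta> - M * \<delta>\<^sup>2)" by simp
  moreover have "K * \<delta> - M * \<delta>\<^sup>2 \<le> K\<^sup>2 / (4 * M)"
  proof -
    have "0 \<le> (2 * M * \<delta> - K)\<^sup>2 / (4 * M)" using \<open>M > 0\<close> by simp
    also have "\<dots> = M * \<delta>\<^sup>2 - K * \<delta> + K\<^sup>2 / (4 * M)"
      using \<open>M > 0\<close> by (simp add: field_simps power2_eq_square)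
    finally show ?thesis by simp
  qed
  ultimately have "\<rho>\<^sup>2 / (2 * t) \<le> h * \<rho> + h\<^sup>2 * t" using MK by linarith
  then have \<rho>_quad: "\<rho> * \<rho> \<le> 2 * (h * t) * \<rho> + 2 * (h * t) * (h * t)"
    using \<open>t > 0\<close> by (simp add: field_simps power2_eq_square)
  have \<rho>_le: "\<rho> \<le> 3 * (h * t)"
  proof (rule ccontr)
    assume "\<not> \<rho> \<le> 3 * (h * t)"
    then have "3 * (h * t) < \<rho>" by simp
    moreover have "0 < h * t" using \<open>h > 0\<close> \<open>t > 0\<close> by simp
    ultimately have "(h * t) * (3 * (h * t)) < (\<rho> - 2 * (h * t)) * \<rho>"
      by (intro mult_strict_mono) auto
    moreover have "0 < (h * t) * (h * t)" using \<open>0 < h * t\<close> by simp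
    ultimately show False using \<rho>_quad by (simp add: algebra_simps)
  qed
  have "h * t = d / 4" using \<open>h > 0\<close> by (simp add: t_def)
  with \<rho>_le have \<rho>_d: "\<rho> \<le> 3 / 4 * d" by simp
  have \<delta>_d: "\<delta> < d / 4"
  proof -
    have "M * \<delta> < M * (d / 4)" using \<open>M * \<delta> \<le> K\<close> Md by simp
    then show ?thesis using \<open>M > 0\<close> by (simp only: mult_less_cancel_left_pos)
  qed
  have y_d: "dist y w0 < d"
  proof -
    have "dist y w0 \<le> \<delta> + dist w w0"
      using dist_triangle[of y w0 w] by (simp add: \<delta>_def dist_norm norm_minus_commute)
    also have "dist w w0 \<le> \<rho>"
      using dist_snd_le[of c c0] by (simp add: c_def c0_def \<rho>_def dist_norm)
    finally show ?thesis using \<delta>_d \<rho>_d by simp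
  qed
  define z where "z = (2 * M) *\<^sub>R (w - y)"
  define q where "q = (v, - z) - (1 / t) *\<^sub>R (c - c0)"
  have "norm z \<le> 2 * L * norm u"
    using \<open>M * \<delta> \<le> K\<close> \<open>M > 0\<close> by (simp add: z_def \<delta>_def K_def)
  moreover have "(z, - u) \<in> regular_normal_cone (gph (single_valued_map F)) (y, F y)"
  proof (rule proximal_normal_imp_regular[where r = "d - dist y w0" and s = M])
    fix p assume p: "p \<in> gph (single_valued_map F)" "dist p (y, F y) < d - dist y w0"
    then obtain y' where p_eq: "p = (y', F y')" by (auto simp: gph_def single_valued_map_def)
    have "dist y' y < d - dist y w0"
      using p(2) dist_fst_le[of p "(y, F y)"] by (simp add: p_eq)
    then have "dist y' w0 \<le> r"
      using dist_triangle[of y' w0 y] \<open>d \<le> r\<close> by simp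
    then have "f m \<le> f (c, y')"
      using \<open>c \<in> C\<close> cd by (intro m) (auto simp: D_def dist_commute)
    then have "u \<bullet> F y + M * (norm (w - y))\<^sup>2 \<le> u \<bullet> F y' + M * (norm (w - y'))\<^sup>2"
      unfolding fm by (simp add: f_def \<delta>_def \<rho>_def c_def)
    moreover have "(norm (w - y'))\<^sup>2 = (norm (w - y))\<^sup>2 - 2 * ((w - y) \<bullet> (y' - y)) + (norm (y' - y))\<^sup>2"
      unfolding power2_norm_eq_inner by (simp add: algebra_simps inner_commute)
    ultimately have "2 * M * ((w - y) \<bullet> (y' - y)) - u \<bullet> (F y' - F y) \<le> M * (norm (y' - y))\<^sup>2"
      by (simp add: algebra_simps)
    also have "\<dots> \<le> M * (norm (p - (y, F y)))\<^sup>2"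
      using \<open>M > 0\<close> norm_fst_le[of "y' - y" "F y' - F y"] by (intro mult_left_mono power_mono) (auto simp: p_eq)
    finally show "(z, - u) \<bullet> (p - (y, F y)) \<le> M * (norm (p - (y, F y)))\<^sup>2"
      by (simp add: z_def p_eq)
  qed (use y_d in \<open>auto simp: gph_def single_valued_map_def\<close>)
  moreover have "q \<in> regular_normal_cone C c"
  proof (rule proximal_normal_imp_regular[where r = "d - \<rho>" and s = "1 / (2 * t) + M"])
    fix c' assume c': "c' \<in> C" "dist c' c < d - \<rho>"
    obtain x' w' where c'_eq: "c' = (x', w')" by fastforce
    have "dist c' c0 \<le> d"
      using c'(2) dist_triangle[of c' c0 c] by (simp add: \<rho>_def dist_norm)
    then have "f m \<le> f (c', y)"
      using c'(1) yr by (intro m) (auto simp: D_def dist_commute)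
    then have "(norm (c - c0))\<^sup>2 / (2 * t) + M * (norm (w - y))\<^sup>2 + v \<bullet> (x' - x)
        \<le> (norm (c' - c0))\<^sup>2 / (2 * t) + M * (norm (w' - y))\<^sup>2"
      unfolding fm by (simp add: f_def \<delta>_def \<rho>_def c'_eq inner_diff_right)
    moreover have "(norm (w' - y))\<^sup>2 = (norm (w - y))\<^sup>2 + 2 * ((w - y) \<bullet> (w' - w)) + (norm (w' - w))\<^sup>2"
      "(norm (c' - c0))\<^sup>2 = (norm (c - c0))\<^sup>2 + 2 * ((c - c0) \<bullet> (c' - c)) + (norm (c' - c))\<^sup>2"
      unfolding power2_norm_eq_inner by (simp_all add: algebra_simps inner_commute)
    ultimately have "v \<bullet> (x' - x) - 2 * M * ((w - y) \<bullet> (w' - w)) - (c - c0) \<bullet> (c' - c) / t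
        \<le> (norm (c' - c))\<^sup>2 / (2 * t) + M * (norm (w' - w))\<^sup>2"
      using \<open>t > 0\<close> by (simp add: field_simps)
    also have "M * (norm (w' - w))\<^sup>2 \<le> M * (norm (c' - c))\<^sup>2"
      using \<open>M > 0\<close> norm_snd_le[of "w' - w" "x' - x"] by (intro mult_left_mono power_mono) (auto simp: c'_eq c_def)
    finally show "q \<bullet> (c' - c) \<le> (1 / (2 * t) + M) * (norm (c' - c))\<^sup>2"
      by (simp add: q_def z_def c_def c'_eq inner_diff_left distrib_right)
  qed (use \<rho>_d \<open>d > 0\<close> \<open>c \<in> C\<close> in auto)
  moreover have "dist q (v, - z) < e"
  proof -
    have "dist q (v, - z) = \<rho> / t" using \<open>t > 0\<close> by (simp add: q_def dist_norm \<rho>_def)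
    also have "\<dots> \<le> 3 * h" using \<rho>_le \<open>t > 0\<close> by (simp add: field_simps)
    finally show ?thesis using \<open>e > 0\<close> by (simp add: h_def)
  qed
  moreover have "dist c (x0, w0) < e"
    using \<rho>_d \<open>d > 0\<close> \<open>d \<le> e\<close> by (simp add: \<rho>_def dist_norm c0_def)
  ultimately show ?thesis
    using that \<open>c \<in> C\<close> \<open>y \<in> W\<close> y_d \<open>d \<le> e\<close> by fastforce
qed

text \<open>
  The fuzzy chain rule with tolerances tending to zero. The multipliers are bounded by the Lipschitz
  constant, so they accumulate at some \<open>z\<close>; closedness of limiting normal cones does the rest. The
  norm bound on \<open>z\<close> is part of the conclusion because a further limit is taken later.
\<close>

lemma chain_rule_limiting_normal:
  fixes C :: "('a::euclidean_space \<times> 'b::euclidean_space) set"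
    and F :: "'b \<Rightarrow> 'c::euclidean_space"
  assumes "closed C" and W: "open W" "w0 \<in> W" and lip: "L-lipschitz_on W F"
    and c: "\<And>j. (x j, w j) \<in> C" "x \<longlonglongrightarrow> x0" "w \<longlonglongrightarrow> w0"
    and n: "\<And>j. (v j, - u j) \<in> regular_normal_cone ((\<lambda>(x, w). (x, F w)) ` C) (x j, F (w j))"
      "v \<longlonglongrightarrow> v0" "u \<longlonglongrightarrow> u0"
  obtains z where "norm z \<le> 2 * L * norm u0" "z \<in> coderivative_fun F w0 u0"
    "(v0, - z) \<in> limiting_normal_cone C (x0, w0)"
proof -
  have "\<forall>\<^sub>F j in sequentially. w j \<in> W" using c(3) W by (rule topological_tendstoD)
  then obtain N where N: "\<And>j. j \<ge> N \<Longrightarrow> w j \<in> W" unfolding eventually_sequentially by blast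
  define e where "e j = inverse (real (Suc j))" for j
  have "e j > 0" for j by (simp add: e_def)
  have e_lim: "e \<longlonglongrightarrow> 0" unfolding e_def by (rule LIMSEQ_inverse_real_of_nat)
  have "\<exists>c y z q. c \<in> C \<and> dist c (x (j + N), w (j + N)) < e j \<and> y \<in> W \<and> dist y (w (j + N)) < e j
      \<and> norm z \<le> 2 * L * norm (u (j + N))
      \<and> (z, - u (j + N)) \<in> regular_normal_cone (gph (single_valued_map F)) (y, F y)
      \<and> q \<in> regular_normal_cone C c \<and> dist q (v (j + N), - z) < e j" for j
    by (rule fuzzy_chain_rule[OF \<open>closed C\<close> c(1) W(1) N[OF le_add2] lip n(1) \<open>e j > 0\<close>]) blast
  then obtain c' y z q where P: "\<And>j. c' j \<in> C" "\<And>j. dist (c' j) (x (j + N), w (j + N)) < e j"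
      "\<And>j. y j \<in> W" "\<And>j. dist (y j) (w (j + N)) < e j" "\<And>j. norm (z j) \<le> 2 * L * norm (u (j + N))"
      "\<And>j. (z j, - u (j + N)) \<in> regular_normal_cone (gph (single_valued_map F)) (y j, F (y j))"
      "\<And>j. q j \<in> regular_normal_cone C (c' j)" "\<And>j. dist (q j) (v (j + N), - z j) < e j"
    by metis
  have near: "a \<longlonglongrightarrow> l" if "\<And>j. dist (a j) (b j) < e j" "b \<longlonglongrightarrow> l"
    for a b :: "nat \<Rightarrow> 'd::real_normed_vector" and l
  proof -
    have "(\<lambda>j. a j - b j) \<longlonglongrightarrow> 0"
      by (rule Lim_null_comparison[OF always_eventually e_lim])
        (use that(1) in \<open>simp add: dist_norm less_imp_le\<close>)
    from tendsto_add[OF this that(2)] show ?thesis by simp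
  qed
  have xN: "(\<lambda>j. (x (j + N), w (j + N))) \<longlonglongrightarrow> (x0, w0)" and vN: "(\<lambda>j. v (j + N)) \<longlonglongrightarrow> v0"
    and uN: "(\<lambda>j. u (j + N)) \<longlonglongrightarrow> u0" and wN: "(\<lambda>j. w (j + N)) \<longlonglongrightarrow> w0"
    using c(2,3) n(2,3) by (auto intro!: tendsto_Pair LIMSEQ_ignore_initial_segment)
  have c'_lim: "c' \<longlonglongrightarrow> (x0, w0)" by (rule near[OF P(2) xN])
  have y_lim: "y \<longlonglongrightarrow> w0" by (rule near[OF P(4) wN])
  have Fy_lim: "(\<lambda>j. F (y j)) \<longlonglongrightarrow> F w0"
    using lipschitz_on_continuous_on[OF lip] y_lim W
    by (intro isCont_tendsto_compose[of w0 F]) (simp_all add: continuous_on_eq_continuous_at)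
  have bound_lim: "(\<lambda>j. 2 * L * norm (u (j + N))) \<longlonglongrightarrow> 2 * L * norm u0"
    by (intro tendsto_intros uN)
  have "bounded (range z)"
  proof -
    obtain B where B: "\<bar>2 * L * norm (u (j + N))\<bar> \<le> B" for j
      using convergent_imp_bounded[OF bound_lim] unfolding bounded_iff by auto
    have "norm (z j) \<le> B" for j using P(5)[of j] B[of j] by linarith
    then show ?thesis by (auto simp: bounded_iff)
  qed
  then obtain z0 s where s: "strict_mono s" "(z \<circ> s) \<longlonglongrightarrow> z0"
    using bounded_imp_convergent_subsequence[of z] by blast
  have sub: "(\<lambda>j. a (s j)) \<longlonglongrightarrow> l" if "a \<longlonglongrightarrow> l" for a :: "nat \<Rightarrow> 'd::topological_space" and l
    using LIMSEQ_subseq_LIMSEQ[OF that s(1)] by (simp add: comp_def)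
  have z_lim: "(\<lambda>j. z (s j)) \<longlonglongrightarrow> z0" using s(2) by (simp add: comp_def)
  have "norm z0 \<le> 2 * L * norm u0"
    by (rule LIMSEQ_le[OF tendsto_norm[OF z_lim] sub[OF bound_lim]]) (use P(5) in auto)
  moreover have "(z0, - u0) \<in> limiting_normal_cone (gph (single_valued_map F)) (w0, F w0)"
  proof (rule limiting_normal_cone_closed)
    show "\<forall>\<^sub>F j in sequentially. (z (s j), - u (s j + N)) \<in>
        limiting_normal_cone (gph (single_valued_map F)) (y (s j), F (y (s j)))"
      using P(6) by (intro always_eventually allI regular_imp_limiting_normal)
    show "(\<lambda>j. (y (s j), F (y (s j)))) \<longlonglongrightarrow> (w0, F w0)"
      by (intro tendsto_Pair sub[OF y_lim] sub[OF Fy_lim])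
    show "(\<lambda>j. (z (s j), - u (s j + N))) \<longlonglongrightarrow> (z0, - u0)"
      by (intro tendsto_Pair tendsto_minus z_lim sub[OF uN])
  qed (simp add: gph_def single_valued_map_def)
  moreover have "(v0, - z0) \<in> limiting_normal_cone C (x0, w0)"
  proof (rule limiting_normal_cone_closed)
    show "\<forall>\<^sub>F j in sequentially. q (s j) \<in> limiting_normal_cone C (c' (s j))"
      using P(7) by (intro always_eventually allI regular_imp_limiting_normal)
    show "(\<lambda>j. c' (s j)) \<longlonglongrightarrow> (x0, w0)" by (rule sub[OF c'_lim])
    have "(\<lambda>j. q (s j) - (v (s j + N), - z (s j))) \<longlonglongrightarrow> 0"
      by (rule Lim_null_comparison[OF always_eventually sub[OF e_lim]])
        (use P(8) in \<open>simp add: dist_norm less_imp_le\<close>)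
    moreover have "(\<lambda>j. (v (s j + N), - z (s j))) \<longlonglongrightarrow> (v0, - z0)"
      by (intro tendsto_Pair tendsto_minus z_lim sub[OF vN])
    ultimately show "(\<lambda>j. q (s j)) \<longlonglongrightarrow> (v0, - z0)"
      using tendsto_add by fastforce
    show "(x0, w0) \<in> C" using closed_sequentially[OF \<open>closed C\<close> _ c'_lim] P(1) by blast
  qed
  ultimately show ?thesis
    using that[of z0] by (simp add: coderivative_fun_def coderivative_def)
qed

text \<open>
  The base points in the image are lifted to \<open>C\<close> and accumulate at some \<open>w1\<close> in the compact set \<open>B\<close>.
  Without continuity of \<open>F\<close> at \<open>w1\<close> nothing more can be said, not even \<open>F w1 = u1\<close>. The Lipschitz
  property is therefore a premise inside the conclusion: it becomes available only for points \<open>w1\<close>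
  that turn out to be near \<open>S\<^sub>0(x)\<close>.
\<close>

lemma lift_limiting_normal:
  fixes C :: "('a::euclidean_space \<times> 'b::euclidean_space) set"
    and F :: "'b \<Rightarrow> 'c::euclidean_space"
  assumes "closed C" and V: "open V" "(x1, u1) \<in> V" and "compact B"
    and B: "\<And>y w. \<lbrakk>(y, w) \<in> C; (y, F w) \<in> V\<rbrakk> \<Longrightarrow> w \<in> B"
    and n: "(a, - b) \<in> limiting_normal_cone ((\<lambda>(x, w). (x, F w)) ` C) (x1, u1)"
  shows "\<exists>w1\<in>B. (x1, w1) \<in> C \<and>
    (\<forall>W L. open W \<and> w1 \<in> W \<and> L-lipschitz_on W F \<longrightarrow> F w1 = u1 \<and>
      (\<exists>z. norm z \<le> 2 * L * norm b \<and> z \<in> coderivative_fun F w1 b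
         \<and> (a, - z) \<in> limiting_normal_cone C (x1, w1)))"
proof -
  let ?R = "(\<lambda>(x, w). (x, F w)) ` C"
  have "(a, - b) \<in> outer_limit ?R (x1, u1) (regular_normal_cone ?R)"
    using n by (simp add: limiting_normal_cone_def split: if_splits)
  then obtain p m where p: "\<And>j::nat. p j \<in> ?R" "p \<longlonglongrightarrow> (x1, u1)"
      and m: "\<And>j. m j \<in> regular_normal_cone ?R (p j)" "m \<longlonglongrightarrow> (a, - b)"
    unfolding outer_limit_def by blast
  have "\<forall>\<^sub>F j in sequentially. p j \<in> V" using p(2) V by (rule topological_tendstoD)
  then obtain N where N: "\<And>j. j \<ge> N \<Longrightarrow> p j \<in> V" unfolding eventually_sequentially by blast
  have "\<exists>c\<in>C. p (j + N) = (fst c, F (snd c))" for j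
    using p(1)[of "j + N"] by force
  then obtain c where c: "\<And>j. c j \<in> C" "\<And>j. p (j + N) = (fst (c j), F (snd (c j)))"
    by metis
  have "snd (c j) \<in> B" for j
    using B[of "fst (c j)" "snd (c j)"] c(1)[of j] c(2)[of j] N[OF le_add2, of j] by simp
  then obtain w1 s where "w1 \<in> B" and s: "strict_mono s" "((\<lambda>j. snd (c j)) \<circ> s) \<longlonglongrightarrow> w1"
    using \<open>compact B\<close> unfolding compact_def by metis
  have sub: "(\<lambda>j. q (s j + N)) \<longlonglongrightarrow> l" if "q \<longlonglongrightarrow> l" for q :: "nat \<Rightarrow> 'd::topological_space" and l
    using LIMSEQ_subseq_LIMSEQ[OF LIMSEQ_ignore_initial_segment[OF that, of N] s(1)]
    by (simp add: comp_def)
  have w_lim: "(\<lambda>j. snd (c (s j))) \<longlonglongrightarrow> w1" using s(2) by (simp add: comp_def)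
  have p_lim: "(\<lambda>j. p (s j + N)) \<longlonglongrightarrow> (x1, u1)" by (rule sub[OF p(2)])
  have x_lim: "(\<lambda>j. fst (c (s j))) \<longlonglongrightarrow> x1" and F_lim: "(\<lambda>j. F (snd (c (s j)))) \<longlonglongrightarrow> u1"
    using tendsto_fst[OF p_lim] tendsto_snd[OF p_lim] by (simp_all add: c(2))
  have c_lim: "(\<lambda>j. c (s j)) \<longlonglongrightarrow> (x1, w1)"
    using tendsto_Pair[OF x_lim w_lim] by (simp only: prod.collapse)
  have "(x1, w1) \<in> C"
    by (rule closed_sequentially[OF \<open>closed C\<close> c(1) c_lim])
  moreover have "F w1 = u1 \<and> (\<exists>z. norm z \<le> 2 * L * norm b \<and> z \<in> coderivative_fun F w1 b
         \<and> (a, - z) \<in> limiting_normal_cone C (x1, w1))"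
    if W: "open W" "w1 \<in> W" and lip: "L-lipschitz_on W F" for W L
  proof
    have "(\<lambda>j. F (snd (c (s j)))) \<longlonglongrightarrow> F w1"
      using lipschitz_on_continuous_on[OF lip] w_lim W
      by (intro isCont_tendsto_compose[of w1 F]) (simp_all add: continuous_on_eq_continuous_at)
    then show "F w1 = u1" using F_lim by (rule LIMSEQ_unique)
    have m_lim: "(\<lambda>j. m (s j + N)) \<longlonglongrightarrow> (a, - b)" by (rule sub[OF m(2)])
    have m_fst: "(\<lambda>j. fst (m (s j + N))) \<longlonglongrightarrow> a" and m_snd: "(\<lambda>j. - snd (m (s j + N))) \<longlonglongrightarrow> b"
      using tendsto_fst[OF m_lim] tendsto_minus[OF tendsto_snd[OF m_lim]] by simp_all
    have "(fst (c (s j)), snd (c (s j))) \<in> C" for j using c(1) by simp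
    moreover have "(fst (m (s j + N)), - (- snd (m (s j + N))))
        \<in> regular_normal_cone ?R (fst (c (s j)), F (snd (c (s j))))" for j
      using m(1)[of "s j + N"] by (simp add: c(2))
    ultimately show "\<exists>z. norm z \<le> 2 * L * norm b \<and> z \<in> coderivative_fun F w1 b
         \<and> (a, - z) \<in> limiting_normal_cone C (x1, w1)"
      by (rule chain_rule_limiting_normal[OF \<open>closed C\<close> W lip _ x_lim w_lim _ m_fst m_snd]) blast
  qed
  ultimately show ?thesis using \<open>w1 \<in> B\<close> by blast
qed

section \<open>The chain rule for projectional coderivatives\<close>

lemma gph_restrict_single_valued_comp:
  "gph (restrict_map_to (sv_comp (single_valued_map F) S0) X)
    = (\<lambda>(x, w). (x, F w)) ` gph (restrict_map_to S0 X)"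
  by (auto simp: gph_def restrict_map_to_def sv_comp_def single_valued_map_def image_iff
      split: if_splits)

text \<open>Outer semicontinuity relative to a closed set is closedness of the restricted graph.\<close>

lemma closed_gph_restrict:
  fixes S0 :: "'a::metric_space \<Rightarrow> 'b::metric_space set"
  assumes "closed X" "osc_relative S0 X"
  shows "closed (gph (restrict_map_to S0 X))"
  unfolding closed_sequential_limits
proof (intro allI impI, elim conjE)
  fix p :: "nat \<Rightarrow> 'a \<times> 'b" and l
  assume p: "\<forall>n. p n \<in> gph (restrict_map_to S0 X)" "p \<longlonglongrightarrow> l"
  have X: "fst (p n) \<in> X" "snd (p n) \<in> S0 (fst (p n))" for n
    using p(1) by (auto simp: gph_def restrict_map_to_def split: if_splits dest!: spec[of _ n])
  have lim: "(\<lambda>n. fst (p n)) \<longlonglongrightarrow> fst l" "(\<lambda>n. snd (p n)) \<longlonglongrightarrow> snd l"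
    by (intro tendsto_intros p(2))+
  have "fst l \<in> X"
    by (rule closed_sequentially[OF \<open>closed X\<close> X(1) lim(1)])
  moreover have "snd l \<in> outer_limit X (fst l) S0"
    by (rule outer_limit_eventuallyI[OF always_eventually lim]) (simp add: X)
  ultimately show "l \<in> gph (restrict_map_to S0 X)"
    using assms(2)
    by (auto simp: osc_relative_def gph_def restrict_map_to_def)
qed

text \<open>
  For each \<open>k\<close> the projected normal is lifted without moving the base point \<open>y k\<close> or the first component
  \<open>a k\<close>, so \<open>\<tau> k\<close> remains a projection of \<open>a k\<close> to the tangent cone at \<open>y k\<close>. The lifted points \<open>w k\<close>
  accumulate at some point of \<open>S0 x\<close>, near which \<open>F\<close> is Lipschitz; this releases the multipliers,
  which are bounded and accumulate as well.
\<close>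

lemma proj_coderivative_chain_rule:
  fixes S0 :: "'a::euclidean_space \<Rightarrow> 'b::euclidean_space set"
    and F :: "'b \<Rightarrow> 'c::euclidean_space"
  assumes "closed X" "osc_relative S0 X" "x \<in> X"
    and strict: "\<forall>w\<in>S0 x. strictly_continuous_at F w"
    and bdd: "locally_bounded_at (\<lambda>(y, v). restrict_map_to S0 X y \<inter> F -` {v}) (x, u)"
    and t: "t \<in> proj_coderivative X (sv_comp (single_valued_map F) S0) x u u'"
  obtains w z where "w \<in> S0 x" "F w = u" "z \<in> coderivative_fun F w u'"
    "t \<in> proj_coderivative X S0 x w z"
proof -
  define C where "C = gph (restrict_map_to S0 X)"
  define R where "R = (\<lambda>(x, w). (x, F w)) ` C"
  have "closed C" unfolding C_def by (rule closed_gph_restrict) fact+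
  have R: "gph (restrict_map_to (sv_comp (single_valued_map F) S0) X) = R"
    by (simp add: R_def C_def gph_restrict_single_valued_comp)
  obtain V where V: "open V" "(x, u) \<in> V"
      and bV: "bounded (\<Union>p\<in>V. case p of (y, v) \<Rightarrow> restrict_map_to S0 X y \<inter> F -` {v})"
    using bdd unfolding locally_bounded_at_def by blast
  define B where "B = closure (\<Union>p\<in>V. case p of (y, v) \<Rightarrow> restrict_map_to S0 X y \<inter> F -` {v})"
  have "compact B" using bV by (simp add: B_def)
  have B: "w \<in> B" if "(y, w) \<in> C" "(y, F w) \<in> V" for y w
    unfolding B_def by (rule closure_subset[THEN subsetD]) (use that in \<open>force simp: C_def gph_def\<close>)
  obtain p m where p: "\<And>k::nat. p k \<in> R" "p \<longlonglongrightarrow> (x, u)"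
      and m: "\<And>k. m k \<in> (case p k of (y, v) \<Rightarrow> proj_set (tangent_cone X y \<times> UNIV) (limiting_normal_cone R (y, v)))"
        "m \<longlonglongrightarrow> (t, - u')"
    using t unfolding proj_coderivative_def outer_limit_def R by blast
  have "\<forall>\<^sub>F k in sequentially. p k \<in> V" using p(2) V by (rule topological_tendstoD)
  then obtain N where N: "\<And>k. k \<ge> N \<Longrightarrow> p k \<in> V" unfolding eventually_sequentially by blast
  define y where "y = (\<lambda>k. fst (p (k + N)))"
  define b where "b = (\<lambda>k. - snd (m (k + N)))"
  define \<tau> where "\<tau> = (\<lambda>k. fst (m (k + N)))"
  have y_lim: "y \<longlonglongrightarrow> x" and F_lim: "(\<lambda>k. snd (p (k + N))) \<longlonglongrightarrow> u"
    and b_lim: "b \<longlonglongrightarrow> u'" and \<tau>_lim: "\<tau> \<longlonglongrightarrow> t"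
    using tendsto_fst[OF LIMSEQ_ignore_initial_segment[OF p(2), of N]]
      tendsto_snd[OF LIMSEQ_ignore_initial_segment[OF p(2), of N]]
      tendsto_fst[OF LIMSEQ_ignore_initial_segment[OF m(2), of N]]
      tendsto_minus[OF tendsto_snd[OF LIMSEQ_ignore_initial_segment[OF m(2), of N]]]
    unfolding y_def b_def \<tau>_def by simp_all
  have "\<exists>a w. \<tau> k \<in> proj_point (tangent_cone X (y k)) a \<and> w \<in> B \<and> (y k, w) \<in> C \<and>
    (\<forall>W L. open W \<and> w \<in> W \<and> L-lipschitz_on W F \<longrightarrow> F w = snd (p (k + N)) \<and>
      (\<exists>z. norm z \<le> 2 * L * norm (b k) \<and> z \<in> coderivative_fun F w (b k)
         \<and> (a, - z) \<in> limiting_normal_cone C (y k, w)))" for k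
  proof -
    have "(\<tau> k, - b k) \<in> proj_set (tangent_cone X (y k) \<times> UNIV) (limiting_normal_cone R (y k, snd (p (k + N))))"
      using m(1)[of "k + N"] by (simp add: \<tau>_def b_def y_def split_beta)
    then obtain a where a: "(a, - b k) \<in> limiting_normal_cone R (y k, snd (p (k + N)))"
        "\<tau> k \<in> proj_point (tangent_cone X (y k)) a"
      unfolding mem_proj_set_times_UNIV by blast
    have "(y k, snd (p (k + N))) \<in> V" using N[OF le_add2, of k] by (simp add: y_def)
    from lift_limiting_normal[OF \<open>closed C\<close> V(1) this \<open>compact B\<close> B a(1)[unfolded R_def]]
    obtain w where w: "w \<in> B" "(y k, w) \<in> C \<and>
      (\<forall>W L. open W \<and> w \<in> W \<and> L-lipschitz_on W F \<longrightarrow> F w = snd (p (k + N)) \<and>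
        (\<exists>z. norm z \<le> 2 * L * norm (b k) \<and> z \<in> coderivative_fun F w (b k)
           \<and> (a, - z) \<in> limiting_normal_cone C (y k, w)))"
      by (rule bexE)
    show ?thesis
      by (rule exI[of _ a], rule exI[of _ w], intro conjI a(2) w(1) w(2)[THEN conjunct1] w(2)[THEN conjunct2])
  qed
  then obtain a w where aw: "\<And>k. \<tau> k \<in> proj_point (tangent_cone X (y k)) (a k)"
      "\<And>k. w k \<in> B" "\<And>k. (y k, w k) \<in> C"
      "\<And>k W L. \<lbrakk>open W; w k \<in> W; L-lipschitz_on W F\<rbrakk> \<Longrightarrow> F (w k) = snd (p (k + N)) \<and>
      (\<exists>z. norm z \<le> 2 * L * norm (b k) \<and> z \<in> coderivative_fun F (w k) (b k)
         \<and> (a k, - z) \<in> limiting_normal_cone C (y k, w k))"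
    by metis
  obtain w0 s where s: "strict_mono s" and "(w \<circ> s) \<longlonglongrightarrow> w0"
    using \<open>compact B\<close> aw(2) unfolding compact_def by metis
  then have w_lim: "(\<lambda>k. w (s k)) \<longlonglongrightarrow> w0" by (simp add: comp_def)
  have sub: "(\<lambda>j. q (r j)) \<longlonglongrightarrow> l" if "q \<longlonglongrightarrow> l" "strict_mono r"
    for q :: "nat \<Rightarrow> 'd::topological_space" and l r
    using LIMSEQ_subseq_LIMSEQ[OF that] by (simp add: comp_def)
  have C0: "(x, w0) \<in> C"
    by (rule closed_sequentially[OF \<open>closed C\<close> aw(3) tendsto_Pair[OF sub[OF y_lim s] w_lim]])
  then have "w0 \<in> S0 x" by (simp add: C_def gph_def restrict_map_to_def split: if_splits)
  then obtain W L where W: "open W" "w0 \<in> W" and lip: "L-lipschitz_on W F"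
    using strict unfolding strictly_continuous_at_def by blast
  have contF: "isCont F w0"
    using lipschitz_on_continuous_on[OF lip] W by (simp add: continuous_on_eq_continuous_at)
  have "\<forall>\<^sub>F k in sequentially. w (s k) \<in> W" using w_lim W by (rule topological_tendstoD)
  then obtain N' where N': "\<And>k. k \<ge> N' \<Longrightarrow> w (s k) \<in> W" unfolding eventually_sequentially by blast
  define s' where "s' k = s (k + N')" for k
  have s': "strict_mono s'" using s by (simp add: s'_def strict_mono_def)
  have w'_lim: "(\<lambda>k. w (s' k)) \<longlonglongrightarrow> w0"
    unfolding s'_def by (rule LIMSEQ_ignore_initial_segment[OF w_lim])
  have *: "F (w (s' k)) = snd (p (s' k + N)) \<and>
      (\<exists>z. norm z \<le> 2 * L * norm (b (s' k)) \<and> z \<in> coderivative_fun F (w (s' k)) (b (s' k))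
         \<and> (a (s' k), - z) \<in> limiting_normal_cone C (y (s' k), w (s' k)))" for k
    unfolding s'_def by (rule aw(4)[OF W(1) N'[OF le_add2] lip])
  then obtain z where z: "\<And>k. norm (z k) \<le> 2 * L * norm (b (s' k))"
      "\<And>k. z k \<in> coderivative_fun F (w (s' k)) (b (s' k))"
      "\<And>k. (a (s' k), - z k) \<in> limiting_normal_cone C (y (s' k), w (s' k))"
    by metis
  have Fw: "(\<lambda>k. F (w (s' k))) \<longlonglongrightarrow> F w0" by (rule isCont_tendsto_compose[OF contF w'_lim])
  moreover have "(\<lambda>k. F (w (s' k))) \<longlonglongrightarrow> u"
    using sub[OF F_lim s'] * by simp
  ultimately have "F w0 = u" by (rule LIMSEQ_unique)
  have "bounded (range z)"
  proof -
    have "(\<lambda>k. 2 * L * norm (b (s' k))) \<longlonglongrightarrow> 2 * L * norm u'"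
      by (intro tendsto_intros sub[OF b_lim s'])
    then obtain K where K: "\<bar>2 * L * norm (b (s' k))\<bar> \<le> K" for k
      using convergent_imp_bounded[of "\<lambda>k. 2 * L * norm (b (s' k))"] unfolding bounded_iff by auto
    have "norm (z k) \<le> K" for k using z(1)[of k] K[of k] by linarith
    then show ?thesis by (auto simp: bounded_iff)
  qed
  then obtain z0 r where r: "strict_mono r" "(z \<circ> r) \<longlonglongrightarrow> z0"
    using bounded_imp_convergent_subsequence[of z] by blast
  have z_lim: "(\<lambda>k. z (r k)) \<longlonglongrightarrow> z0" using r(2) by (simp add: comp_def)
  define \<sigma> where "\<sigma> k = s' (r k)" for k
  have \<sigma>: "strict_mono \<sigma>" using s' r(1) by (simp add: \<sigma>_def strict_mono_def)
  have w\<sigma>: "(\<lambda>k. w (\<sigma> k)) \<longlonglongrightarrow> w0" unfolding \<sigma>_def by (rule sub[OF w'_lim r(1)])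
  have "(z0, - u') \<in> limiting_normal_cone (gph (single_valued_map F)) (w0, F w0)"
  proof (rule limiting_normal_cone_closed)
    show "\<forall>\<^sub>F k in sequentially. (z (r k), - b (\<sigma> k)) \<in>
        limiting_normal_cone (gph (single_valued_map F)) (w (\<sigma> k), F (w (\<sigma> k)))"
      using z(2) by (simp add: \<sigma>_def coderivative_fun_def coderivative_def)
    show "(\<lambda>k. (w (\<sigma> k), F (w (\<sigma> k)))) \<longlonglongrightarrow> (w0, F w0)"
      by (intro tendsto_Pair w\<sigma> isCont_tendsto_compose[OF contF w\<sigma>])
    show "(\<lambda>k. (z (r k), - b (\<sigma> k))) \<longlonglongrightarrow> (z0, - u')"
      by (intro tendsto_Pair tendsto_minus z_lim sub[OF b_lim \<sigma>])
  qed (simp add: gph_def single_valued_map_def)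
  then have "z0 \<in> coderivative_fun F w0 u'" by (simp add: coderivative_fun_def coderivative_def)
  moreover have "(t, - z0) \<in> outer_limit C (x, w0)
      (\<lambda>(y, v). proj_set (tangent_cone X y \<times> UNIV) (limiting_normal_cone C (y, v)))"
  proof (rule outer_limit_eventuallyI)
    show "\<forall>\<^sub>F k in sequentially. (y (\<sigma> k), w (\<sigma> k)) \<in> C \<and> (\<tau> (\<sigma> k), - z (r k)) \<in>
        (case (y (\<sigma> k), w (\<sigma> k)) of (y, v) \<Rightarrow>
          proj_set (tangent_cone X y \<times> UNIV) (limiting_normal_cone C (y, v)))"
      using aw(1,3) z(3) by (auto simp: mem_proj_set_times_UNIV \<sigma>_def intro!: always_eventually)
    show "(\<lambda>k. (y (\<sigma> k), w (\<sigma> k))) \<longlonglongrightarrow> (x, w0)"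
      by (intro tendsto_Pair w\<sigma> sub[OF y_lim \<sigma>])
    show "(\<lambda>k. (\<tau> (\<sigma> k), - z (r k))) \<longlonglongrightarrow> (t, - z0)"
      by (intro tendsto_Pair tendsto_minus z_lim sub[OF \<tau>_lim \<sigma>])
  qed
  then have "t \<in> proj_coderivative X S0 x w0 z0" by (simp add: proj_coderivative_def C_def)
  ultimately show ?thesis using that \<open>w0 \<in> S0 x\<close> \<open>F w0 = u\<close> by blast
qed

section \<open>Tangent spaces of smooth manifolds\<close>

lemma tangent_cone_iff:
  "h \<in> tangent_cone C y \<longleftrightarrow> y \<in> C \<and>
    (\<exists>s c. (\<forall>k. 0 < s k) \<and> s \<longlonglongrightarrow> (0::real) \<and> (\<forall>k. c k \<in> C) \<and> (\<lambda>k. (c k - y) /\<^sub>R s k) \<longlonglongrightarrow> h)"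
  (is "_ \<longleftrightarrow> _ \<and> ?R")
proof -
  have "h \<in> outer_limit {0<..} 0 (\<lambda>t. (\<lambda>c. (c - y) /\<^sub>R t) ` C) \<longleftrightarrow> ?R"
  proof
    assume "h \<in> outer_limit {0<..} 0 (\<lambda>t. (\<lambda>c. (c - y) /\<^sub>R t) ` C)"
    then obtain s w where s: "\<And>k::nat. s k > 0" "s \<longlonglongrightarrow> 0" and w: "\<And>k. w k \<in> (\<lambda>c. (c - y) /\<^sub>R s k) ` C" "w \<longlonglongrightarrow> h"
      unfolding outer_limit_def by auto
    from w(1) obtain c where c: "\<And>k. c k \<in> C" "\<And>k. w k = (c k - y) /\<^sub>R s k"
      unfolding image_iff by metis
    from w(2) have "(\<lambda>k. (c k - y) /\<^sub>R s k) \<longlonglongrightarrow> h" by (simp add: c(2)[symmetric])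
    with s c(1) show ?R by blast
  next
    assume ?R
    then obtain s c where "\<forall>k. 0 < s k" "s \<longlonglongrightarrow> 0" "\<forall>k. c k \<in> C" "(\<lambda>k. (c k - y) /\<^sub>R s k) \<longlonglongrightarrow> h"
      by blast
    then show "h \<in> outer_limit {0<..} 0 (\<lambda>t. (\<lambda>c. (c - y) /\<^sub>R t) ` C)"
      unfolding outer_limit_def by (intro CollectI exI[of _ s] exI[of _ "\<lambda>k. (c k - y) /\<^sub>R s k"]) auto
  qed
  then show ?thesis by (simp add: tangent_cone_def)
qed

text \<open>First-order expansion of \<open>g\<close>, which vanishes along the sequence defining \<open>h\<close>.\<close>

lemma tangent_orthogonal_gradient:
  fixes g :: "'a::euclidean_space \<Rightarrow> real"
  assumes g: "GDERIV g y :> D" and zero: "\<forall>\<^sub>F z in nhds y. z \<in> X \<longrightarrow> g z = 0"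
    and h: "h \<in> tangent_cone X y"
  shows "D \<bullet> h = 0"
proof -
  obtain s c where s: "\<And>k. 0 < s k" "s \<longlonglongrightarrow> (0::real)" and c: "\<And>k. c k \<in> X"
      and h_lim: "(\<lambda>k. (c k - y) /\<^sub>R s k) \<longlonglongrightarrow> h" and "y \<in> X"
    using h unfolding tangent_cone_iff by blast
  have "(\<lambda>k. s k *\<^sub>R ((c k - y) /\<^sub>R s k)) \<longlonglongrightarrow> 0 *\<^sub>R h"
    by (intro tendsto_scaleR s h_lim)
  moreover have "s k *\<^sub>R ((c k - y) /\<^sub>R s k) = c k - y" for k
    using s(1)[of k] by simp
  ultimately have "(\<lambda>k. c k - y) \<longlonglongrightarrow> 0" by simp
  then have c_lim: "c \<longlonglongrightarrow> y" by (simp add: LIM_zero_iff)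
  have "g y = 0" using eventually_nhds_x_imp_x[OF zero] \<open>y \<in> X\<close> by simp
  have "\<bar>D \<bullet> h\<bar> \<le> e * norm h" if "e > 0" for e
  proof -
    obtain d where "d > 0" and d: "\<And>z. norm (z - y) < d \<Longrightarrow> norm (g z - g y - (z - y) \<bullet> D) \<le> e * norm (z - y)"
      using g \<open>e > 0\<close> unfolding gderiv_def has_derivative_at_alt by blast
    have "\<forall>\<^sub>F k in sequentially. g (c k) = 0"
      using eventually_compose_filterlim[OF zero c_lim] c by simp
    moreover have "\<forall>\<^sub>F k in sequentially. dist (c k) y < d" by (rule tendstoD[OF c_lim \<open>d > 0\<close>])
    ultimately have "\<forall>\<^sub>F k in sequentially. \<bar>D \<bullet> ((c k - y) /\<^sub>R s k)\<bar> \<le> e * norm ((c k - y) /\<^sub>R s k)"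
    proof eventually_elim
      case (elim k)
      then have "\<bar>D \<bullet> (c k - y)\<bar> \<le> e * norm (c k - y)"
        using d[of "c k"] \<open>g y = 0\<close> by (simp add: dist_norm inner_commute)
      then have "inverse (s k) * \<bar>D \<bullet> (c k - y)\<bar> \<le> inverse (s k) * (e * norm (c k - y))"
        using s(1)[of k] by (intro mult_left_mono) simp_all
      then show ?case using s(1)[of k] by (simp add: abs_mult mult.left_commute)
    qed
    moreover have "(\<lambda>k. \<bar>D \<bullet> ((c k - y) /\<^sub>R s k)\<bar>) \<longlonglongrightarrow> \<bar>D \<bullet> h\<bar>"
      "(\<lambda>k. e * norm ((c k - y) /\<^sub>R s k)) \<longlonglongrightarrow> e * norm h"
      by (intro tendsto_intros h_lim)+
    ultimately show ?thesis by (intro tendsto_le[OF sequentially_bot])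
  qed
  then have "\<bar>D \<bullet> h\<bar> \<le> 0" by (rule le_zero_if_le_small_multiple) auto
  then show ?thesis by simp
qed

text \<open>The rank condition says that the \<open>a i\<close> are distinct and independent, so the coordinate
  functionals extend to the whole space; Riesz representation gives the \<open>b j\<close>.\<close>

lemma dual_family:
  fixes a :: "nat \<Rightarrow> 'a::euclidean_space"
  assumes "dim (a ` {..<q}) = q"
  obtains b where "\<And>i j. \<lbrakk>i < q; j < q\<rbrakk> \<Longrightarrow> a i \<bullet> b j = (if i = j then 1 else 0)"
proof -
  have "card (a ` {..<q}) = q"
    using dim_le_card'[of "a ` {..<q}"] card_image_le[of "{..<q}" a] assms by simp
  then have inj: "inj_on a {..<q}" by (intro eq_card_imp_inj_on) auto
  have indep: "independent (a ` {..<q})"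
    using assms \<open>card (a ` {..<q}) = q\<close> by (intro card_le_dim_spanning[of _ "a ` {..<q}"]) (auto intro!: span_base)
  have "\<exists>v. \<forall>i<q. a i \<bullet> v = (if i = j then 1 else 0)" if "j < q" for j
  proof -
    obtain f :: "'a \<Rightarrow> real" where f: "linear f" "\<forall>p \<in> a ` {..<q}. f p = (if p = a j then 1 else 0)"
      using linear_independent_extend[OF indep, of "\<lambda>p. if p = a j then 1 else 0"] by blast
    have "a i \<bullet> adjoint f 1 = (if i = j then 1 else 0)" if "i < q" for i
      using f(2) adjoint_works[OF f(1), of "a i" 1] inj that \<open>j < q\<close> by (auto simp: inj_on_def)
    then show ?thesis by blast
  qed
  then obtain b where "\<forall>j<q. \<forall>i<q. a i \<bullet> b j = (if i = j then 1 else 0)" by metis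
  then show ?thesis using that by blast
qed

text \<open>
  One inclusion is first-order expansion. For the other, the map
  \<open>\<Phi> z = z + (\<Sum>i<q. (G i z - DG i x \<bullet> z) b i)\<close> with \<open>b\<close> dual to the gradients at \<open>x\<close> has derivative
  \<open>id\<close> at \<open>x\<close> and satisfies \<open>DG j x \<bullet> \<Phi> z = G j z\<close>: it straightens \<open>X\<close> to the orthogonal complement of
  the gradients at \<open>x\<close>. The inverse function theorem at the single point \<open>x\<close> provides a local inverse
  that is differentiable at all nearby points, and thus for every \<open>y \<in> X\<close> near \<open>x\<close> and every \<open>h\<close>
  orthogonal to the gradients at \<open>y\<close> a curve in \<open>X\<close> with velocity \<open>h\<close>.
\<close>

lemma tangent_cone_level_set:
  fixes G :: "nat \<Rightarrow> 'a::euclidean_space \<Rightarrow> real" and X :: "'a set"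
  assumes "open U" "x \<in> U"
    and G: "\<And>i y. \<lbrakk>i < q; y \<in> U\<rbrakk> \<Longrightarrow> GDERIV (G i) y :> DG i y"
    and cont: "\<And>i. i < q \<Longrightarrow> continuous_on U (DG i)"
    and rank: "dim ((\<lambda>i. DG i x) ` {..<q}) = q"
    and X: "X \<inter> U = {y \<in> U. \<forall>i<q. G i y = 0}"
  obtains U' where "open U'" "x \<in> U'" "U' \<subseteq> U"
    "\<And>y. y \<in> X \<inter> U' \<Longrightarrow> tangent_cone X y = {h. \<forall>i<q. DG i y \<bullet> h = 0}"
proof -
  obtain b where b: "\<And>i j. \<lbrakk>i < q; j < q\<rbrakk> \<Longrightarrow> DG i x \<bullet> b j = (if i = j then 1 else 0)"
    using dual_family[OF rank] by blast
  define \<Phi> where "\<Phi> z = z + (\<Sum>i<q. (G i z - DG i x \<bullet> z) *\<^sub>R b i)" for z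
  define \<Phi>' where "\<Phi>' z = id_blinfun + (\<Sum>i<q. blinfun_scaleR_left (b i) o\<^sub>L blinfun_inner_left (DG i z - DG i x))" for z
  have \<Phi>'_apply: "blinfun_apply (\<Phi>' z) h = h + (\<Sum>i<q. ((DG i z - DG i x) \<bullet> h) *\<^sub>R b i)" for z h
    by (simp add: \<Phi>'_def blinfun.add_left blinfun.sum_left inner_commute)
  have \<Phi>_coord: "DG j x \<bullet> \<Phi> z = G j z" if "j < q" for j z
  proof -
    have "DG j x \<bullet> \<Phi> z = DG j x \<bullet> z + (\<Sum>i<q. (G i z - DG i x \<bullet> z) * (if j = i then 1 else 0))"
      using that by (simp add: \<Phi>_def inner_add_right inner_sum_right b)
    then show ?thesis using that by (simp add: if_distrib cong: if_cong)
  qed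
  have der: "(\<Phi> has_derivative blinfun_apply (\<Phi>' z)) (at z)" if "z \<in> U" for z
  proof -
    have "((\<lambda>z. z + (\<Sum>i<q. (G i z - DG i x \<bullet> z) *\<^sub>R b i)) has_derivative
      (\<lambda>h. h + (\<Sum>i<q. (h \<bullet> DG i z - DG i x \<bullet> h) *\<^sub>R b i))) (at z)"
      using G[OF _ that] unfolding gderiv_def by (auto intro!: derivative_eq_intros)
    then show ?thesis
      unfolding \<Phi>_def[abs_def] by (rule has_derivative_eq_rhs) (simp add: \<Phi>'_apply fun_eq_iff inner_diff_left inner_diff_right inner_commute)
  qed
  have cont': "continuous_on U \<Phi>'"
    unfolding \<Phi>'_def[abs_def] by (auto intro!: continuous_intros cont)
  have "id_blinfun o\<^sub>L \<Phi>' x = id_blinfun"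
    by (rule blinfun_eqI) (simp add: \<Phi>'_apply)
  then obtain U' V g g' where U': "open U'" "U' \<subseteq> U" "x \<in> U'" and "open V"
      and hom: "homeomorphism U' V \<Phi> g"
      and g: "\<And>y. y \<in> V \<Longrightarrow> (g has_derivative (g' y)) (at y)"
        "\<And>y. y \<in> V \<Longrightarrow> g' y = inv (blinfun_apply (\<Phi>' (g y)))"
        "\<And>y. y \<in> V \<Longrightarrow> bij (blinfun_apply (\<Phi>' (g y)))"
    using inverse_function_theorem[OF \<open>open U\<close> der cont' \<open>x \<in> U\<close>] by metis
  have "tangent_cone X y = {h. \<forall>i<q. DG i y \<bullet> h = 0}" if y: "y \<in> X \<inter> U'" for y
  proof (intro set_eqI iffI)
    have "y \<in> U" using y U' by blast
    {
      fix h assume h: "h \<in> tangent_cone X y"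
      have "DG i y \<bullet> h = 0" if "i < q" for i
      proof (rule tangent_orthogonal_gradient[OF G[OF that \<open>y \<in> U\<close>] _ h])
        show "\<forall>\<^sub>F z in nhds y. z \<in> X \<longrightarrow> G i z = 0"
          using eventually_nhds_in_open[OF \<open>open U\<close> \<open>y \<in> U\<close>] by eventually_elim (use X that in blast)
      qed
      then show "h \<in> {h. \<forall>i<q. DG i y \<bullet> h = 0}" by blast
    next
      fix h assume "h \<in> {h. \<forall>i<q. DG i y \<bullet> h = 0}"
      then have h: "\<And>i. i < q \<Longrightarrow> DG i y \<bullet> h = 0" by blast
      \<comment> \<open>the direction corresponding to \<open>h\<close> in the straightened picture\<close>
      define k where "k = blinfun_apply (\<Phi>' y) h"
      have k: "DG j x \<bullet> k = 0" if "j < q" for j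
      proof -
        have "k = h - (\<Sum>i<q. (DG i x \<bullet> h) *\<^sub>R b i)"
          using h by (simp add: k_def \<Phi>'_apply inner_diff_left sum_negf)
        then have "DG j x \<bullet> k = DG j x \<bullet> h - (\<Sum>i<q. (DG i x \<bullet> h) * (if j = i then 1 else 0))"
          using that by (simp add: inner_diff_right inner_sum_right b)
        then show ?thesis using that by (simp add: if_distrib cong: if_cong)
      qed
      have "\<Phi> y \<in> V" and gy: "g (\<Phi> y) = y" using hom y by (auto simp: homeomorphism_def)
      \<comment> \<open>the preimage of a straight line, a curve in \<open>X\<close> through \<open>y\<close>\<close>
      define \<gamma> where "\<gamma> s = g (\<Phi> y + s *\<^sub>R k)" for s :: real
      have "(\<gamma> has_derivative (\<lambda>s. g' (\<Phi> y) (s *\<^sub>R k))) (at 0)"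
        unfolding \<gamma>_def[abs_def] using g(1)[OF \<open>\<Phi> y \<in> V\<close>]
        by (intro has_derivative_compose[of "\<lambda>s. \<Phi> y + s *\<^sub>R k" "\<lambda>s. s *\<^sub>R k" _ _ g])
          (auto intro!: derivative_eq_intros)
      moreover have "g' (\<Phi> y) (s *\<^sub>R k) = s *\<^sub>R h" for s
      proof -
        have "s *\<^sub>R k = blinfun_apply (\<Phi>' y) (s *\<^sub>R h)" by (simp add: k_def blinfun.scaleR_right)
        then show ?thesis
          using g(2,3)[OF \<open>\<Phi> y \<in> V\<close>] by (simp add: gy inv_f_f bij_is_inj)
      qed
      moreover have "\<gamma> 0 = y" by (simp add: \<gamma>_def gy)
      ultimately have "((\<lambda>s. norm (\<gamma> s - y - s *\<^sub>R h) / norm s) \<longlongrightarrow> 0) (at 0)"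
        by (simp add: has_derivative_at)
      moreover have "\<forall>\<^sub>F s in at 0. norm (\<gamma> s - y - s *\<^sub>R h) / norm s = norm ((\<gamma> s - y) /\<^sub>R s - h)"
        unfolding eventually_at_filter
      proof (intro always_eventually allI impI)
        fix s :: real assume "s \<noteq> 0"
        then have "(\<gamma> s - y) /\<^sub>R s - h = (\<gamma> s - y - s *\<^sub>R h) /\<^sub>R s" by (simp add: scaleR_diff_right)
        then show "norm (\<gamma> s - y - s *\<^sub>R h) / norm s = norm ((\<gamma> s - y) /\<^sub>R s - h)"
          by (simp add: divide_inverse_commute)
      qed
      ultimately have "((\<lambda>s. norm ((\<gamma> s - y) /\<^sub>R s - h)) \<longlongrightarrow> 0) (at 0)"
        by (rule Lim_transform_eventually)
      then have quot: "((\<lambda>s. (\<gamma> s - y) /\<^sub>R s) \<longlongrightarrow> h) (at 0)"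
        by (rule LIM_zero_cancel[OF tendsto_norm_zero_cancel])
      have "((\<lambda>s. \<Phi> y + s *\<^sub>R k) \<longlongrightarrow> \<Phi> y + 0 *\<^sub>R k) (nhds 0)"
        by (intro tendsto_intros filterlim_ident)
      then have "\<forall>\<^sub>F s in nhds 0. \<Phi> y + s *\<^sub>R k \<in> V"
        using topological_tendstoD[OF _ \<open>open V\<close>] \<open>\<Phi> y \<in> V\<close> by simp
      then have inX: "\<forall>\<^sub>F s in nhds 0. \<gamma> s \<in> X"
      proof eventually_elim
        case (elim s)
        then have \<gamma>U: "\<gamma> s \<in> U" and \<Phi>\<gamma>: "\<Phi> (\<gamma> s) = \<Phi> y + s *\<^sub>R k"
          using hom U' by (auto simp: homeomorphism_def \<gamma>_def)
        have "G j (\<gamma> s) = 0" if "j < q" for j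
        proof -
          have "G j (\<gamma> s) = G j y + s * (DG j x \<bullet> k)"
            using \<Phi>_coord[OF that, of "\<gamma> s"] \<Phi>_coord[OF that, of y] by (simp add: \<Phi>\<gamma> inner_add_right)
          moreover have "G j y = 0" using X y \<open>y \<in> U\<close> that by blast
          ultimately show ?thesis using k[OF that] by simp
        qed
        with X \<gamma>U show ?case by blast
      qed
      define \<sigma> where "\<sigma> k = inverse (real (Suc k))" for k
      have \<sigma>: "\<sigma> \<longlonglongrightarrow> 0" "\<And>k. \<sigma> k > 0"
        unfolding \<sigma>_def by (rule LIMSEQ_inverse_real_of_nat) simp
      then have \<sigma>_at: "filterlim \<sigma> (at 0) sequentially"
        by (auto simp: filterlim_at less_imp_neq[symmetric] intro!: always_eventually)
      have "h \<in> outer_limit {0<..} 0 (\<lambda>t. (\<lambda>c. (c - y) /\<^sub>R t) ` X)"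
      proof (rule outer_limit_eventuallyI)
        show "\<forall>\<^sub>F k in sequentially. \<sigma> k \<in> {0<..} \<and> (\<gamma> (\<sigma> k) - y) /\<^sub>R \<sigma> k \<in> (\<lambda>c. (c - y) /\<^sub>R \<sigma> k) ` X"
          using eventually_compose_filterlim[OF inX \<sigma>(1)] by eventually_elim (use \<sigma>(2) in auto)
        show "(\<lambda>k. (\<gamma> (\<sigma> k) - y) /\<^sub>R \<sigma> k) \<longlonglongrightarrow> h"
          by (rule filterlim_compose[OF quot \<sigma>_at])
      qed (rule \<sigma>(1))
      with y show "h \<in> tangent_cone X y" by (simp add: tangent_cone_def)
    }
  qed
  then show ?thesis using that U' by blast
qed

text \<open>The two properties of tangent cones that the equality needs: they are subspaces near \<open>x\<close>, and
  tangency survives limits of base points, by continuity of the gradients.\<close>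

lemma smooth_manifold_tangent_spaces:
  fixes X :: "'a::euclidean_space set"
  assumes "smooth_manifold_around d X x"
  obtains U where "open U" "x \<in> U" "\<And>y. y \<in> X \<inter> U \<Longrightarrow> subspace (tangent_cone X y)"
    "outer_limit (X \<inter> U) x (tangent_cone X) \<subseteq> tangent_cone X x"
proof -
  define q where "q = DIM('a) - d"
  obtain U G DG where U: "open U" "x \<in> U"
      and G: "\<And>i y. \<lbrakk>i < q; y \<in> U\<rbrakk> \<Longrightarrow> GDERIV (G i) y :> DG i y"
      and cont: "\<And>i. i < q \<Longrightarrow> continuous_on U (DG i)"
      and rank: "dim ((\<lambda>i. DG i x) ` {..<q}) = q"
      and X: "X \<inter> U = {y \<in> U. \<forall>i<q. G i y = (0::real)}" and "x \<in> X"
    using assms unfolding smooth_manifold_around_def q_def by blast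
  obtain U' where U': "open U'" "x \<in> U'" "U' \<subseteq> U"
      and T: "\<And>y. y \<in> X \<inter> U' \<Longrightarrow> tangent_cone X y = {h. \<forall>i<q. DG i y \<bullet> h = 0}"
    using tangent_cone_level_set[OF U G cont rank X] by blast
  have "subspace {h. \<forall>i<q. DG i y \<bullet> h = 0}" for y
    by (auto simp: subspace_def inner_add_right)
  with T have "subspace (tangent_cone X y)" if "y \<in> X \<inter> U'" for y
    using that by simp
  moreover have "outer_limit (X \<inter> U') x (tangent_cone X) \<subseteq> tangent_cone X x"
  proof
    fix h assume "h \<in> outer_limit (X \<inter> U') x (tangent_cone X)"
    then obtain y w where y: "\<And>k::nat. y k \<in> X \<inter> U'" "y \<longlonglongrightarrow> x"
        and w: "\<And>k. w k \<in> tangent_cone X (y k)" "w \<longlonglongrightarrow> h"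
      unfolding outer_limit_def by blast
    have "DG i x \<bullet> h = 0" if "i < q" for i
    proof -
      have "isCont (DG i) x" using cont[OF that] U by (simp add: continuous_on_eq_continuous_at)
      then have "(\<lambda>k. DG i (y k) \<bullet> w k) \<longlonglongrightarrow> DG i x \<bullet> h"
        by (intro tendsto_inner w isCont_tendsto_compose[OF _ y(2)])
      moreover have "DG i (y k) \<bullet> w k = 0" for k using w(1)[of k] T[OF y(1)[of k]] that by simp
      ultimately show ?thesis by (simp add: LIMSEQ_const_iff)
    qed
    with T[of x] \<open>x \<in> X\<close> U' show "h \<in> tangent_cone X x" by simp
  qed
  ultimately show ?thesis using that U' by blast
qed

section \<open>Convex graphs\<close>

text \<open>Shrinking \<open>c'\<close> towards \<open>c\<close> keeps the quotient in the definition of regular normals constant, which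
  makes the local condition global; in this form it passes to limits of base points.\<close>

lemma limiting_normal_cone_convex:
  fixes C :: "'a::real_inner set"
  assumes "convex C"
  shows "v \<in> limiting_normal_cone C c \<longleftrightarrow> c \<in> C \<and> (\<forall>c'\<in>C. v \<bullet> (c' - c) \<le> 0)"
proof
  have reg: "v \<bullet> (c' - c) \<le> 0" if "v \<in> regular_normal_cone C c" "c' \<in> C" for v c c'
  proof -
    have "c \<in> C" using that(1) by (simp add: regular_normal_cone_iff)
    have "v \<bullet> (c' - c) \<le> e * norm (c' - c)" if "e > 0" for e
    proof -
      obtain d where "d > 0" and d: "\<And>p. \<lbrakk>p \<in> C; dist p c < d\<rbrakk> \<Longrightarrow> v \<bullet> (p - c) \<le> e * norm (p - c)"
        using \<open>v \<in> regular_normal_cone C c\<close> \<open>e > 0\<close> unfolding regular_normal_cone_iff by blast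
      define N where "N = norm (c' - c) + 1"
      have "N > 0" by (simp add: N_def add_nonneg_pos)
      define s where "s = min 1 (d / (2 * N))"
      have s: "0 < s" "s \<le> 1" using \<open>d > 0\<close> \<open>N > 0\<close> by (auto simp: s_def)
      have "s * norm (c' - c) \<le> d / (2 * N) * N"
        using s \<open>N > 0\<close> by (intro mult_mono) (auto simp: s_def N_def)
      also have "\<dots> = d / 2" using \<open>N > 0\<close> by simp
      finally have "s * norm (c' - c) < d" using \<open>d > 0\<close> by simp
      moreover have "c + s *\<^sub>R (c' - c) \<in> C"
        using convexD_alt[OF assms \<open>c \<in> C\<close> \<open>c' \<in> C\<close>, of s] s by (simp add: algebra_simps)
      ultimately have "s * (v \<bullet> (c' - c)) \<le> s * (e * norm (c' - c))"
        using d[of "c + s *\<^sub>R (c' - c)"] s by (simp add: dist_norm mult.left_commute)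
      then show ?thesis using s by simp
    qed
    then show ?thesis by (rule le_zero_if_le_small_multiple) auto
  qed
  assume "v \<in> limiting_normal_cone C c"
  then have "c \<in> C" and "v \<in> outer_limit C c (regular_normal_cone C)"
    by (auto simp: limiting_normal_cone_def split: if_splits)
  then obtain p w where p: "p \<longlonglongrightarrow> c" and w: "\<And>k::nat. w k \<in> regular_normal_cone C (p k)" "w \<longlonglongrightarrow> v"
    unfolding outer_limit_def by blast
  have "v \<bullet> (c' - c) \<le> 0" if "c' \<in> C" for c'
  proof (rule LIMSEQ_le_const2)
    show "(\<lambda>k. w k \<bullet> (c' - p k)) \<longlonglongrightarrow> v \<bullet> (c' - c)" by (intro tendsto_intros p w(2))
    show "\<exists>N. \<forall>k\<ge>N. w k \<bullet> (c' - p k) \<le> 0" using reg[OF w(1) that] by blast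
  qed
  with \<open>c \<in> C\<close> show "c \<in> C \<and> (\<forall>c'\<in>C. v \<bullet> (c' - c) \<le> 0)" by blast
next
  assume "c \<in> C \<and> (\<forall>c'\<in>C. v \<bullet> (c' - c) \<le> 0)"
  then show "v \<in> limiting_normal_cone C c"
    by (intro regular_imp_limiting_normal proximal_normal_imp_regular[of c C 1 v 0]) auto
qed

lemma segment_direction_tangent:
  fixes D :: "'a::real_normed_vector set"
  assumes "convex D" "D \<subseteq> X" "y \<in> D" "y' \<in> D"
  shows "y' - y \<in> tangent_cone X y"
  unfolding tangent_cone_iff
proof (intro conjI exI allI)
  let ?s = "\<lambda>k. inverse (real (Suc k))"
  show "?s \<longlonglongrightarrow> 0" by (rule LIMSEQ_inverse_real_of_nat)
  show "y + ?s k *\<^sub>R (y' - y) \<in> X" for k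
    using convexD_alt[OF assms(1,3,4), of "?s k"] assms(2)
    by (auto simp: algebra_simps inverse_le_1_iff simp del: of_nat_Suc)
  show "(\<lambda>k. (y + ?s k *\<^sub>R (y' - y) - y) /\<^sub>R ?s k) \<longlonglongrightarrow> y' - y"
    by (simp del: of_nat_Suc)
qed (use assms in \<open>auto simp del: of_nat_Suc\<close>)

text \<open>
  Let \<open>a\<close> be the unprojected first component at \<open>p k\<close>. The difference of \<open>a\<close> and its projection is
  orthogonal to the tangent space, and hence to all directions from \<open>p k\<close> to points of \<open>R\<close>, seen in
  \<open>X\<close>. So the projected vector is itself normal to \<open>R\<close>. This controls the limit although the
  unprojected vectors may be unbounded. Conversely, a normal with tangent first component is
  its own projection, and the constant sequence realizes it.
\<close>

lemma outer_limit_projected_normals_convex: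
  fixes R :: "('a::euclidean_space \<times> 'b::euclidean_space) set"
  assumes "convex R" "R \<subseteq> X \<times> UNIV" "(x, u) \<in> R" "smooth_manifold_around d X x"
  shows "(t, b) \<in> outer_limit R (x, u)
      (\<lambda>(y, v). proj_set (tangent_cone X y \<times> UNIV) (limiting_normal_cone R (y, v)))
    \<longleftrightarrow> t \<in> tangent_cone X x \<and> (t, b) \<in> limiting_normal_cone R (x, u)"
    (is "_ \<in> outer_limit R (x, u) ?P \<longleftrightarrow> _")
proof
  assume "t \<in> tangent_cone X x \<and> (t, b) \<in> limiting_normal_cone R (x, u)"
  then have "(t, b) \<in> ?P (x, u)"
    using proj_point_self by (auto simp: mem_proj_set_times_UNIV)
  with assms(3) show "(t, b) \<in> outer_limit R (x, u) ?P"
    by (intro outer_limit_eventuallyI[of "\<lambda>_. (x, u)" R "\<lambda>_. (t, b)"]) auto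
next
  assume "(t, b) \<in> outer_limit R (x, u) ?P"
  then obtain p m where p: "\<And>k::nat. p k \<in> R" "p \<longlonglongrightarrow> (x, u)"
      and m: "\<And>k. m k \<in> ?P (p k)" "m \<longlonglongrightarrow> (t, b)"
    unfolding outer_limit_def by blast
  obtain U where U: "open U" "x \<in> U" and sub: "\<And>y. y \<in> X \<inter> U \<Longrightarrow> subspace (tangent_cone X y)"
      and osc: "outer_limit (X \<inter> U) x (tangent_cone X) \<subseteq> tangent_cone X x"
    using smooth_manifold_tangent_spaces[OF assms(4)] by blast
  have "convex (fst ` R)" by (rule convex_linear_image[OF linear_fst \<open>convex R\<close>])
  have fstR: "fst ` R \<subseteq> X" using assms(2) by auto
  have p_lim: "(\<lambda>k. fst (p k)) \<longlonglongrightarrow> x" and m_lim: "(\<lambda>k. fst (m k)) \<longlonglongrightarrow> t"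
    using tendsto_fst[OF p(2)] tendsto_fst[OF m(2)] by simp_all
  have "\<forall>\<^sub>F k in sequentially. fst (p k) \<in> U" by (rule topological_tendstoD[OF p_lim U])
  then have ev: "\<forall>\<^sub>F k in sequentially. fst (p k) \<in> X \<inter> U \<and> fst (m k) \<in> tangent_cone X (fst (p k))
      \<and> m k \<in> limiting_normal_cone R (p k)"
  proof eventually_elim
    case (elim k)
    have yX: "fst (p k) \<in> X \<inter> U" using elim p(1)[of k] assms(2) by auto
    have "(fst (m k), snd (m k)) \<in> proj_set (tangent_cone X (fst (p k)) \<times> UNIV) (limiting_normal_cone R (p k))"
      using m(1)[of k] by (simp add: split_beta)
    then obtain a where a: "(a, snd (m k)) \<in> limiting_normal_cone R (p k)"
        and proj: "fst (m k) \<in> proj_point (tangent_cone X (fst (p k))) a"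
      unfolding mem_proj_set_times_UNIV by blast
    have "m k \<bullet> (r - p k) \<le> 0" if "r \<in> R" for r
    proof -
      have "fst r - fst (p k) \<in> tangent_cone X (fst (p k))"
        using \<open>convex (fst ` R)\<close> fstR p(1)[of k] that by (intro segment_direction_tangent[of "fst ` R"]) auto
      then have "(a - fst (m k)) \<bullet> (fst r - fst (p k)) = 0"
        by (rule proj_point_subspace_orthogonal[OF sub[OF yX] proj])
      then have "m k \<bullet> (r - p k) = (a, snd (m k)) \<bullet> (r - p k)"
        by (simp add: inner_prod_def inner_diff_left)
      also have "\<dots> \<le> 0"
        using a that by (simp add: limiting_normal_cone_convex[OF \<open>convex R\<close>])
      finally show ?thesis .
    qed
    then have "m k \<in> limiting_normal_cone R (p k)"
      using p(1)[of k] by (simp add: limiting_normal_cone_convex[OF \<open>convex R\<close>])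
    then show ?case using yX proj by (simp add: proj_point_iff)
  qed
  have "t \<in> outer_limit (X \<inter> U) x (tangent_cone X)"
    by (rule outer_limit_eventuallyI[OF _ p_lim m_lim]) (use ev in eventually_elim, blast)
  with osc have "t \<in> tangent_cone X x" by blast
  moreover have "(t, b) \<in> limiting_normal_cone R (x, u)"
    by (rule limiting_normal_cone_closed[OF _ p(2) m(2) assms(3)]) (use ev in eventually_elim, blast)
  ultimately show "t \<in> tangent_cone X x \<and> (t, b) \<in> limiting_normal_cone R (x, u)" by blast
qed

text \<open>Both sides are described by normals of convex sets at the base points, where \<open>F\<close> moves to the
  other side of the inner product as its adjoint.\<close>

lemma proj_coderivative_linear_image:
  fixes S0 :: "'a::euclidean_space \<Rightarrow> 'b::euclidean_space set"
    and F :: "'b \<Rightarrow> 'c::euclidean_space"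
  assumes convex: "graph_convex (restrict_map_to S0 X)" and manifold: "smooth_manifold_around d X x"
    and "linear F" and w: "w \<in> S0 x"
  shows "proj_coderivative X (sv_comp (single_valued_map F) S0) x (F w) u'
    = proj_coderivative X S0 x w (adjoint F u')"
proof -
  define C where "C = gph (restrict_map_to S0 X)"
  let ?A = "\<lambda>(x, w). (x, F w)"
  have "convex C" using convex by (simp add: graph_convex_def C_def)
  have "linear ?A" using \<open>linear F\<close>
    by (auto simp: linear_iff)
  then have "convex (?A ` C)" using \<open>convex C\<close> by (rule convex_linear_image)
  have "x \<in> X" using manifold by (simp add: smooth_manifold_around_def)
  then have xw: "(x, w) \<in> C" using w by (simp add: C_def gph_def restrict_map_to_def)
  have CX: "C \<subseteq> X \<times> UNIV" by (auto simp: C_def gph_def restrict_map_to_def split: if_splits)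
  have "(t, - u') \<in> limiting_normal_cone (?A ` C) (x, F w)
      \<longleftrightarrow> (t, - adjoint F u') \<in> limiting_normal_cone C (x, w)" for t
  proof -
    have adj: "u' \<bullet> (F w' - F w) = adjoint F u' \<bullet> (w' - w)" for w'
      using adjoint_works[OF \<open>linear F\<close>, of "w' - w" u'] \<open>linear F\<close>
      by (simp add: linear_diff inner_commute)
    have "(x, F w) \<in> ?A ` C" using xw by force
    then show ?thesis
      unfolding limiting_normal_cone_convex[OF \<open>convex C\<close>] limiting_normal_cone_convex[OF \<open>convex (?A ` C)\<close>]
      using xw by (simp add: split_beta inner_prod_def adj)
  qed
  moreover have "(t, - u') \<in> outer_limit (?A ` C) (x, F w)
      (\<lambda>(y, v). proj_set (tangent_cone X y \<times> UNIV) (limiting_normal_cone (?A ` C) (y, v)))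
    \<longleftrightarrow> t \<in> tangent_cone X x \<and> (t, - u') \<in> limiting_normal_cone (?A ` C) (x, F w)" for t
    using CX xw
    by (intro outer_limit_projected_normals_convex[OF \<open>convex (?A ` C)\<close> _ _ manifold]) force+
  moreover have "(t, - adjoint F u') \<in> outer_limit C (x, w)
      (\<lambda>(y, v). proj_set (tangent_cone X y \<times> UNIV) (limiting_normal_cone C (y, v)))
    \<longleftrightarrow> t \<in> tangent_cone X x \<and> (t, - adjoint F u') \<in> limiting_normal_cone C (x, w)" for t
    by (rule outer_limit_projected_normals_convex[OF \<open>convex C\<close> CX xw manifold])
  ultimately show ?thesis
    unfolding proj_coderivative_def gph_restrict_single_valued_comp C_def[symmetric] by simp
qed

section \<open>Coderivatives of compositions\<close>

theorem corollary5p2: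
  fixes X :: "(real ^ 'n) set"
    and S0 :: "real ^ 'n \<Rightarrow> (real ^ 'p) set"
    and F :: "real ^ 'p \<Rightarrow> real ^ 'm"
    and S :: "real ^ 'n \<Rightarrow> (real ^ 'm) set"
    and x :: "real ^ 'n" and u :: "real ^ 'm"
  assumes "closed X"
    and "S = sv_comp (single_valued_map F) S0"
    and "osc_relative S0 X"
    and "u \<in> restrict_map_to S X x"
    and "\<forall>w\<in>S0 x. strictly_continuous_at F w"
    and "locally_bounded_at (\<lambda>(y, v). restrict_map_to S0 X y \<inter> F -` {v}) (x, u)"
  shows "(\<forall>u'. proj_coderivative X S x u u'
            \<subseteq> (\<Union>w \<in> S0 x \<inter> F -` {u}. sv_comp (proj_coderivative X S0 x w) (coderivative_fun F w) u'))
       \<and> (graph_convex (restrict_map_to S0 X) \<and> (\<exists>d. smooth_manifold_around d X x) \<and> linear F \<longrightarrow>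
            (\<forall>w \<in> S0 x \<inter> F -` {u}.
               proj_coderivative X S x u
                 = sv_comp (proj_coderivative X S0 x w)
                     (single_valued_map (adjoint (frechet_derivative F (at w))))))"
proof (intro conjI allI impI ballI)
  have "x \<in> X" using assms(4) by (simp add: restrict_map_to_def split: if_splits)
  show "proj_coderivative X S x u u'
      \<subseteq> (\<Union>w \<in> S0 x \<inter> F -` {u}. sv_comp (proj_coderivative X S0 x w) (coderivative_fun F w) u')" for u'
  proof
    fix t assume "t \<in> proj_coderivative X S x u u'"
    then obtain w z where "w \<in> S0 x" "F w = u" "z \<in> coderivative_fun F w u'"
        "t \<in> proj_coderivative X S0 x w z"
      using proj_coderivative_chain_rule[OF assms(1,3) \<open>x \<in> X\<close> assms(5,6)] assms(2) by metis
    then show "t \<in> (\<Union>w \<in> S0 x \<inter> F -` {u}. sv_comp (proj_coderivative X S0 x w) (coderivative_fun F w) u')"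
      unfolding sv_comp_def by blast
  qed
next
  fix w
  assume *: "graph_convex (restrict_map_to S0 X) \<and> (\<exists>d. smooth_manifold_around d X x) \<and> linear F"
    and w: "w \<in> S0 x \<inter> F -` {u}"
  then obtain d where d: "smooth_manifold_around d X x" by blast
  have F': "frechet_derivative F (at w) = F"
    using * by (metis frechet_derivative_at linear_imp_has_derivative)
  show "proj_coderivative X S x u
      = sv_comp (proj_coderivative X S0 x w) (single_valued_map (adjoint (frechet_derivative F (at w))))"
  proof
    fix u'
    have "proj_coderivative X S x u u' = proj_coderivative X S0 x w (adjoint F u')"
      using proj_coderivative_linear_image[of S0 X d x F w u'] * d w assms(2) by simp
    then show "proj_coderivative X S x u u'
        = sv_comp (proj_coderivative X S0 x w) (single_valued_map (adjoint (frechet_derivative F (at w)))) u'"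
      by (simp add: F' sv_comp_def single_valued_map_def)
  qed
qed

end
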